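(* Let $k$ be a field of characteristic $\ne 2$, let $V$ be a non-empty set of non-trivial discrete valuations on $k$, let $i, j \geq 1$ be integers, and let $s$ be an integer with $1 \leq s \leq i$. If all quadratic forms over $k$ of dimension $m_{i,j}(k) + s - 1$ satisfy $\mathrm{LGP}(r,j)$ with respect to $V$ for some integer $r \geq 1$, then so do all quadratic forms over $k$ of dimension $< m_{i,j}(k)$.
   Context: All quadratic forms are regular; $i_W(q)$ is the Witt index of $q$. For integers $i,j\ge1$, $m_{i,j}(k)$ is the infimum of $\dim q \ge 1$ over quadratic forms $q$ over $k$ such that $i_W(q) < j$ and $i_W(q \perp \sigma_i) \geq j$ for every $i$-dimensional quadratic form $\sigma_i$ over $k$, with the infimum of the empty set equal to $\infty$. For $v \in V$, $k_v$ is the $v$-adic completion and $q_v = q_{k_v}$. A form $q$ over $k$ satisfies $\mathrm{LGP}(r,j)$ with respect to $V$ if ($i_W(q_v) \ge r$ for all $v \in V$) implies $i_W(q) \ge j$.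
   Formalization: The formal statement assumes that m_{i,j}(k) is finite, since otherwise no form has dimension m_{i,j}(k)+s-1 and the claim fails (k = Q, V = {2-adic}, i = j = r = s = 1, form <1,1,1,1,1>). *)

theory Defs
  imports "HOL-Algebra.QuotRing" "HOL-Library.Extended" "HOL-Library.Extended_Nat"
begin

text \<open>
  Fields are HOL-Algebra structures, so that a field and all its completions are treated by the
  same definitions.  In characteristic not 2 a quadratic form is given by its symmetric Gram
  matrix.  A matrix is a function on pairs of indices; for an \<open>n\<close>-dimensional form only the
  entries with both indices below \<open>n\<close> are meaningful.  The zero form (dimension 0) is allowed.
\<close>

datatype 'a qform = QForm (qdim: nat) (gram: "nat \<Rightarrow> nat \<Rightarrow> 'a")

definition square_mat :: "('a, 'b) ring_scheme \<Rightarrow> nat \<Rightarrow> (nat \<Rightarrow> nat \<Rightarrow> 'a) \<Rightarrow> bool" where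
  "square_mat F n A \<longleftrightarrow> (\<forall>a<n. \<forall>b<n. A a b \<in> carrier F)"

definition mat_times ::
  "('a, 'b) ring_scheme \<Rightarrow> nat \<Rightarrow> (nat \<Rightarrow> nat \<Rightarrow> 'a) \<Rightarrow> (nat \<Rightarrow> nat \<Rightarrow> 'a) \<Rightarrow> nat \<Rightarrow> nat \<Rightarrow> 'a" where
  "mat_times F n A B = (\<lambda>a b. \<Oplus>\<^bsub>F\<^esub>c\<in>{..<n}. A a c \<otimes>\<^bsub>F\<^esub> B c b)"

definition mat_id :: "('a, 'b) ring_scheme \<Rightarrow> nat \<Rightarrow> nat \<Rightarrow> 'a" where
  "mat_id F = (\<lambda>a b. if a = b then \<one>\<^bsub>F\<^esub> else \<zero>\<^bsub>F\<^esub>)"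

definition mat_eq :: "nat \<Rightarrow> (nat \<Rightarrow> nat \<Rightarrow> 'a) \<Rightarrow> (nat \<Rightarrow> nat \<Rightarrow> 'a) \<Rightarrow> bool" where
  "mat_eq n A B \<longleftrightarrow> (\<forall>a<n. \<forall>b<n. A a b = B a b)"

definition invertible_mat :: "('a, 'b) ring_scheme \<Rightarrow> nat \<Rightarrow> (nat \<Rightarrow> nat \<Rightarrow> 'a) \<Rightarrow> bool" where
  "invertible_mat F n A \<longleftrightarrow> square_mat F n A \<and>
     (\<exists>B. square_mat F n B \<and> mat_eq n (mat_times F n A B) (mat_id F)
        \<and> mat_eq n (mat_times F n B A) (mat_id F))"

definition regular_qform :: "('a, 'b) ring_scheme \<Rightarrow> 'a qform \<Rightarrow> bool" where
  "regular_qform F q \<longleftrightarrow>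
     (\<forall>a<qdim q. \<forall>b<qdim q. gram q a b = gram q b a) \<and> invertible_mat F (qdim q) (gram q)"

definition isometric :: "('a, 'b) ring_scheme \<Rightarrow> 'a qform \<Rightarrow> 'a qform \<Rightarrow> bool" where
  "isometric F q q' \<longleftrightarrow> qdim q = qdim q' \<and>
     (\<exists>C. invertible_mat F (qdim q) C \<and>
        mat_eq (qdim q) (gram q)
          (mat_times F (qdim q) (\<lambda>a b. C b a) (mat_times F (qdim q) (gram q') C)))"

definition orth_sum :: "('a, 'b) ring_scheme \<Rightarrow> 'a qform \<Rightarrow> 'a qform \<Rightarrow> 'a qform" where
  "orth_sum F q q' = QForm (qdim q + qdim q')
     (\<lambda>a b. if a < qdim q \<and> b < qdim q then gram q a b
            else if qdim q \<le> a \<and> qdim q \<le> b then gram q' (a - qdim q) (b - qdim q)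
            else \<zero>\<^bsub>F\<^esub>)"

definition hyperbolic_plane :: "('a, 'b) ring_scheme \<Rightarrow> 'a qform" where
  "hyperbolic_plane F = QForm 2
     (\<lambda>a b. if a \<noteq> b then \<zero>\<^bsub>F\<^esub> else if a = 0 then \<one>\<^bsub>F\<^esub> else \<ominus>\<^bsub>F\<^esub> \<one>\<^bsub>F\<^esub>)"

primrec hyperbolic_form :: "('a, 'b) ring_scheme \<Rightarrow> nat \<Rightarrow> 'a qform" where
  "hyperbolic_form F 0 = QForm 0 (\<lambda>a b. \<zero>\<^bsub>F\<^esub>)"
| "hyperbolic_form F (Suc m) = orth_sum F (hyperbolic_plane F) (hyperbolic_form F m)"

text \<open>
  The Witt index of a regular form is the largest number of hyperbolic planes that split off
  from it as an orthogonal summand.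
  The set below contains 0 and is bounded by half the dimension of \<open>q\<close>.
\<close>

definition witt_index :: "('a, 'b) ring_scheme \<Rightarrow> 'a qform \<Rightarrow> nat" where
  "witt_index F q =
     Max {m. \<exists>q'. regular_qform F q' \<and> isometric F q (orth_sum F (hyperbolic_form F m) q')}"

text \<open>The infimum of the empty set in \<^typ>\<open>enat\<close> is infinity.\<close>

definition m_invariant :: "('a, 'b) ring_scheme \<Rightarrow> nat \<Rightarrow> nat \<Rightarrow> enat" where
  "m_invariant F i j = Inf {enat (qdim q) | q.
     regular_qform F q \<and> 1 \<le> qdim q \<and> witt_index F q < j \<and>
     (\<forall>\<sigma>. regular_qform F \<sigma> \<and> qdim \<sigma> = i \<longrightarrow> j \<le> witt_index F (orth_sum F q \<sigma>))}"

text \<open>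
  The value group is a subgroup of the integers, not necessarily all of them; the value of zero
  is \<^const>\<open>Pinf\<close>.
\<close>

definition discrete_valuation :: "('a, 'b) ring_scheme \<Rightarrow> ('a \<Rightarrow> int extended) \<Rightarrow> bool" where
  "discrete_valuation F v \<longleftrightarrow>
     v \<zero>\<^bsub>F\<^esub> = Pinf \<and>
     (\<forall>x\<in>carrier F. x \<noteq> \<zero>\<^bsub>F\<^esub> \<longrightarrow> v x \<in> range Fin) \<and>
     (\<forall>x\<in>carrier F. \<forall>y\<in>carrier F. v (x \<otimes>\<^bsub>F\<^esub> y) = v x + v y) \<and>
     (\<forall>x\<in>carrier F. \<forall>y\<in>carrier F. min (v x) (v y) \<le> v (x \<oplus>\<^bsub>F\<^esub> y))"

definition nontrivial_valuation :: "('a, 'b) ring_scheme \<Rightarrow> ('a \<Rightarrow> int extended) \<Rightarrow> bool" where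
  "nontrivial_valuation F v \<longleftrightarrow> (\<exists>x\<in>carrier F. x \<noteq> \<zero>\<^bsub>F\<^esub> \<and> v x \<noteq> 0)"

definition cauchy_seqs :: "('a, 'b) ring_scheme \<Rightarrow> ('a \<Rightarrow> int extended) \<Rightarrow> (nat \<Rightarrow> 'a) set" where
  "cauchy_seqs F v = {x. (\<forall>n. x n \<in> carrier F) \<and>
     (\<forall>N. \<exists>M. \<forall>m\<ge>M. \<forall>n\<ge>M. Fin N \<le> v (x m \<ominus>\<^bsub>F\<^esub> x n))}"

definition null_seqs :: "('a, 'b) ring_scheme \<Rightarrow> ('a \<Rightarrow> int extended) \<Rightarrow> (nat \<Rightarrow> 'a) set" where
  "null_seqs F v = {x. (\<forall>n. x n \<in> carrier F) \<and> (\<forall>N. \<exists>M. \<forall>n\<ge>M. Fin N \<le> v (x n))}"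

definition cauchy_ring :: "('a, 'b) ring_scheme \<Rightarrow> ('a \<Rightarrow> int extended) \<Rightarrow> (nat \<Rightarrow> 'a) ring" where
  "cauchy_ring F v =
     \<lparr>carrier = cauchy_seqs F v,
      mult = (\<lambda>x y n. x n \<otimes>\<^bsub>F\<^esub> y n), one = (\<lambda>n. \<one>\<^bsub>F\<^esub>),
      zero = (\<lambda>n. \<zero>\<^bsub>F\<^esub>), add = (\<lambda>x y n. x n \<oplus>\<^bsub>F\<^esub> y n)\<rparr>"

definition completion :: "('a, 'b) ring_scheme \<Rightarrow> ('a \<Rightarrow> int extended) \<Rightarrow> (nat \<Rightarrow> 'a) set ring" where
  "completion F v = cauchy_ring F v Quot null_seqs F v"

definition completion_embed ::
  "('a, 'b) ring_scheme \<Rightarrow> ('a \<Rightarrow> int extended) \<Rightarrow> 'a \<Rightarrow> (nat \<Rightarrow> 'a) set" where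
  "completion_embed F v a = null_seqs F v +>\<^bsub>cauchy_ring F v\<^esub> (\<lambda>n. a)"

definition base_change ::
  "('a, 'b) ring_scheme \<Rightarrow> ('a \<Rightarrow> int extended) \<Rightarrow> 'a qform \<Rightarrow> (nat \<Rightarrow> 'a) set qform" where
  "base_change F v q = QForm (qdim q) (\<lambda>a b. completion_embed F v (gram q a b))"

definition LGP ::
  "('a, 'b) ring_scheme \<Rightarrow> ('a \<Rightarrow> int extended) set \<Rightarrow> nat \<Rightarrow> nat \<Rightarrow> 'a qform \<Rightarrow> bool" where
  "LGP F V r j q \<longleftrightarrow>
     ((\<forall>v\<in>V. r \<le> witt_index (completion F v) (base_change F v q)) \<longrightarrow> j \<le> witt_index F q)"

end

theory Submission
  imports Defs
begin

text \<open>
  A form \<open>q\<close> of positive dimension below \<open>m\<^sub>i\<^sub>,\<^sub>j(k)\<close> with \<open>i\<^sub>W(q) < j\<close> admits, by definition of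
  the invariant, a form \<open>\<sigma>\<close> of dimension \<open>i\<close> such that \<open>q \<bottom> \<sigma>\<close> still has Witt index below \<open>j\<close>;
  since \<open>\<sigma>\<close> is diagonalisable, any smaller dimension can be added as well.  Adding one
  dimension at a time up to \<open>m\<^sub>i\<^sub>,\<^sub>j(k) - 1\<close> and then \<open>s\<close> dimensions at once embeds \<open>q\<close> into a form of
  dimension \<open>m\<^sub>i\<^sub>,\<^sub>j(k) + s - 1\<close> and Witt index below \<open>j\<close>.  Local Witt indices can only grow under
  this embedding, so a failure of the local-global principle for \<open>q\<close> gives one in that dimension.
  For \<open>q = 0\<close> the principle is vacuous, because \<open>r \<ge> 1\<close> and \<open>V\<close> is non-empty.
\<close>

subsection \<open>Matrices and isometries\<close>

abbreviation (input) mat_transp :: "(nat \<Rightarrow> nat \<Rightarrow> 'a) \<Rightarrow> nat \<Rightarrow> nat \<Rightarrow> 'a" where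
  "mat_transp A \<equiv> \<lambda>a b. A b a"

lemma mat_eq_refl [simp]: "mat_eq n A A"
  by (simp add: mat_eq_def)

lemma mat_eq_sym: "mat_eq n A B \<Longrightarrow> mat_eq n B A"
  by (simp add: mat_eq_def)

lemma mat_eq_trans [trans]: "mat_eq n A B \<Longrightarrow> mat_eq n B C \<Longrightarrow> mat_eq n A C"
  by (simp add: mat_eq_def)

lemma square_mat_mat_eq: "square_mat F n A \<Longrightarrow> mat_eq n A B \<Longrightarrow> square_mat F n B"
  by (simp add: mat_eq_def square_mat_def)

lemma square_mat_transp: "square_mat F n A \<Longrightarrow> square_mat F n (mat_transp A)"
  by (simp add: square_mat_def)

context cring
begin

section \<open>Finite sums in a commutative ring\<close>

lemma finsum_add_index:
  fixes n m :: nat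
  assumes "\<And>c. c < n + m \<Longrightarrow> f c \<in> carrier R"
  shows "(\<Oplus>c\<in>{..<n + m}. f c) = (\<Oplus>c\<in>{..<n}. f c) \<oplus> (\<Oplus>c\<in>{..<m}. f (n + c))"
  using assms
proof (induction m)
  case 0
  then show ?case by (simp add: Pi_def)
next
  case (Suc m)
  then show ?case
    by (simp add: lessThan_Suc Pi_def a_ac)
qed

lemma finsum_swap:
  assumes "finite A" "finite B" "\<And>a b. a \<in> A \<Longrightarrow> b \<in> B \<Longrightarrow> f a b \<in> carrier R"
  shows "(\<Oplus>a\<in>A. \<Oplus>b\<in>B. f a b) = (\<Oplus>b\<in>B. \<Oplus>a\<in>A. f a b)"
  using assms(1,3)
proof (induction A)
  case (insert x A)
  have "(\<Oplus>b\<in>B. f x b) \<oplus> (\<Oplus>b\<in>B. \<Oplus>a\<in>A. f a b) = (\<Oplus>b\<in>B. f x b \<oplus> (\<Oplus>a\<in>A. f a b))"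
    using insert.prems by (intro finsum_addf [symmetric]) (auto intro!: finsum_closed)
  also have "\<dots> = (\<Oplus>b\<in>B. \<Oplus>a\<in>insert x A. f a b)"
    using insert by (intro finsum_cong') (auto intro!: finsum_closed simp: Pi_def)
  finally show ?case
    using insert by (simp add: Pi_def finsum_closed)
qed simp

text \<open>The factor \<open>t\<close> is left general so that the lemma covers both the entries of
  the identity matrix and the extra row of an elementary matrix.\<close>

lemma finsum_delta:
  assumes "k < (n::nat)" "\<And>c. c < n \<Longrightarrow> f c \<in> carrier R" "t \<in> carrier R"
  shows "(\<Oplus>c\<in>{..<n}. f c \<otimes> (if c = k then t else \<zero>)) = f k \<otimes> t"
    (is "?S = _")
proof -
  have "?S = (\<Oplus>c\<in>{..<n}. if k = c then f c \<otimes> t else \<zero>)"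
    using assms by (intro finsum_cong') auto
  also have "\<dots> = f k \<otimes> t"
    using assms by (subst finsum_singleton) auto
  finally show ?thesis .
qed

section \<open>Matrix algebra, with equality tested on the meaningful indices\<close>

lemma square_mat_times [simp]:
  "square_mat R n A \<Longrightarrow> square_mat R n B \<Longrightarrow> square_mat R n (mat_times R n A B)"
  by (auto simp: square_mat_def mat_times_def intro!: finsum_closed)

lemma square_mat_id [simp]: "square_mat R n (mat_id R)"
  by (simp add: square_mat_def mat_id_def)

text \<open>\<open>mat_eq\<close> ignores entries outside the given size, so matrices cannot be
  replaced by rewriting; this rule replaces factors inside a product instead.\<close>

lemma mat_times_cong:
  assumes "mat_eq n A A'" "mat_eq n B B'" "square_mat R n A" "square_mat R n B"
  shows "mat_eq n (mat_times R n A B) (mat_times R n A' B')"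
  using assms unfolding mat_eq_def mat_times_def square_mat_def
  by (auto intro!: finsum_cong')

lemma mat_times_id:
  assumes "square_mat R n A"
  shows "mat_eq n (mat_times R n A (mat_id R)) A" "mat_eq n (mat_times R n (mat_id R) A) A"
proof -
  show "mat_eq n (mat_times R n A (mat_id R)) A"
    using assms finsum_delta[where t = \<one>]
    by (simp add: mat_eq_def mat_times_def mat_id_def square_mat_def)
  have "(\<Oplus>c\<in>{..<n}. (if a = c then \<one> else \<zero>) \<otimes> A c b) = A a b" if "a < n" "b < n" for a b
  proof -
    have "(\<Oplus>c\<in>{..<n}. (if a = c then \<one> else \<zero>) \<otimes> A c b) = (\<Oplus>c\<in>{..<n}. if a = c then A c b else \<zero>)"
      using assms that by (intro finsum_cong') (auto simp: square_mat_def)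
    also have "\<dots> = A a b"
      using assms that by (subst finsum_singleton) (auto simp: square_mat_def)
    finally show ?thesis .
  qed
  then show "mat_eq n (mat_times R n (mat_id R) A) A"
    by (simp add: mat_eq_def mat_times_def mat_id_def)
qed

lemma mat_times_assoc:
  assumes A: "square_mat R n A" and B: "square_mat R n B" and C: "square_mat R n C"
  shows "mat_eq n (mat_times R n (mat_times R n A B) C) (mat_times R n A (mat_times R n B C))"
  unfolding mat_eq_def
proof (intro allI impI)
  fix a b assume ab: "a < n" "b < n"
  note cl = A[unfolded square_mat_def] B[unfolded square_mat_def] C[unfolded square_mat_def]
  have "mat_times R n (mat_times R n A B) C a b
      = (\<Oplus>d\<in>{..<n}. \<Oplus>c\<in>{..<n}. A a c \<otimes> B c d \<otimes> C d b)"
    unfolding mat_times_def using ab cl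
    by (intro finsum_cong' finsum_ldistr) (auto intro!: finsum_closed)
  also have "\<dots> = (\<Oplus>c\<in>{..<n}. \<Oplus>d\<in>{..<n}. A a c \<otimes> B c d \<otimes> C d b)"
    using ab cl by (intro finsum_swap) auto
  also have "\<dots> = (\<Oplus>c\<in>{..<n}. \<Oplus>d\<in>{..<n}. A a c \<otimes> (B c d \<otimes> C d b))"
    using ab cl by (intro finsum_cong' refl) (auto intro!: finsum_closed simp: m_assoc)
  also have "\<dots> = mat_times R n A (mat_times R n B C) a b"
    unfolding mat_times_def using ab cl
    by (intro finsum_cong' finsum_rdistr [symmetric]) (auto intro!: finsum_closed)
  finally show "mat_times R n (mat_times R n A B) C a b = mat_times R n A (mat_times R n B C) a b" .
qed

lemma transp_mat_times:
  assumes "square_mat R n A" "square_mat R n B"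
  shows "mat_eq n (mat_transp (mat_times R n A B)) (mat_times R n (mat_transp B) (mat_transp A))"
  using assms unfolding mat_eq_def mat_times_def square_mat_def
  by (auto intro!: finsum_cong' simp: m_comm)

section \<open>Invertible matrices\<close>

lemma invertible_matI:
  assumes "square_mat R n A" "square_mat R n B"
    and "mat_eq n (mat_times R n A B) (mat_id R)" "mat_eq n (mat_times R n B A) (mat_id R)"
  shows "invertible_mat R n A"
  using assms by (auto simp: invertible_mat_def)

text \<open>Associativity brings \<open>B\<close> and \<open>B'\<close> together. The lemma yields
  the inverse \<open>B' A'\<close> of a product \<open>A B\<close>.\<close>

lemma mat_times_cancel_inner:
  assumes sq: "square_mat R n A" "square_mat R n B" "square_mat R n B'" "square_mat R n C"
    and inv: "mat_eq n (mat_times R n B B') (mat_id R)"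
  shows "mat_eq n (mat_times R n (mat_times R n A B) (mat_times R n B' C)) (mat_times R n A C)"
proof -
  have "mat_eq n (mat_times R n (mat_times R n A B) (mat_times R n B' C))
      (mat_times R n A (mat_times R n B (mat_times R n B' C)))"
    using sq by (intro mat_times_assoc) auto
  also have "mat_eq n \<dots> (mat_times R n A (mat_times R n (mat_times R n B B') C))"
    using sq by (intro mat_times_cong mat_eq_sym[OF mat_times_assoc]) auto
  also have "mat_eq n \<dots> (mat_times R n A (mat_times R n (mat_id R) C))"
    using sq inv by (intro mat_times_cong) auto
  also have "mat_eq n \<dots> (mat_times R n A C)"
    using sq by (intro mat_times_cong mat_times_id) auto
  finally show ?thesis .
qed

lemma invertible_mat_times:
  assumes "invertible_mat R n A" "invertible_mat R n B"
  shows "invertible_mat R n (mat_times R n A B)"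
proof -
  obtain A' B' where sq: "square_mat R n A" "square_mat R n B" "square_mat R n A'" "square_mat R n B'"
    and A': "mat_eq n (mat_times R n A A') (mat_id R)" "mat_eq n (mat_times R n A' A) (mat_id R)"
    and B': "mat_eq n (mat_times R n B B') (mat_id R)" "mat_eq n (mat_times R n B' B) (mat_id R)"
    using assms by (auto simp: invertible_mat_def)
  show ?thesis
    using sq A' B'
    by (intro invertible_matI[where B = "mat_times R n B' A'"])
      (auto intro: mat_eq_trans[OF mat_times_cancel_inner])
qed

lemma invertible_mat_transp:
  assumes "invertible_mat R n A"
  shows "invertible_mat R n (mat_transp A)"
proof -
  obtain A' where sq: "square_mat R n A" "square_mat R n A'"
    and A': "mat_eq n (mat_times R n A A') (mat_id R)" "mat_eq n (mat_times R n A' A) (mat_id R)"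
    using assms by (auto simp: invertible_mat_def)
  \<comment> \<open>Transposing \<open>X Y = 1\<close> gives \<open>Y^T X^T = 1\<close>; used for
    both orders of the product, it shows that the transposed inverse inverts the transposed
    matrix.\<close>
  have tr: "mat_eq n (mat_times R n (mat_transp Y) (mat_transp X)) (mat_id R)"
    if "square_mat R n X" "square_mat R n Y" "mat_eq n (mat_times R n X Y) (mat_id R)" for X Y
  proof -
    have "mat_eq n (mat_transp (mat_times R n X Y)) (mat_id R)"
      using that(3) by (auto simp: mat_eq_def mat_id_def)
    then show ?thesis
      using transp_mat_times[OF that(1,2)] mat_eq_sym mat_eq_trans by blast
  qed
  show ?thesis
    by (rule invertible_matI[OF square_mat_transp[OF sq(1)] square_mat_transp[OF sq(2)]
          tr[OF sq(2,1) A'(2)] tr[OF sq A'(1)]])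
qed

lemma invertible_mat_id: "invertible_mat R n (mat_id R)"
  by (rule invertible_matI[where B = "mat_id R"]) (auto intro: mat_times_id)

lemma invertible_mat_cong:
  assumes "invertible_mat R n A" "mat_eq n A A'"
  shows "invertible_mat R n A'"
proof -
  obtain B where sq: "square_mat R n A" "square_mat R n B"
    and B: "mat_eq n (mat_times R n A B) (mat_id R)" "mat_eq n (mat_times R n B A) (mat_id R)"
    using assms by (auto simp: invertible_mat_def)
  have "square_mat R n A'"
    using sq assms square_mat_mat_eq by blast
  with sq B assms(2) show ?thesis
    by (intro invertible_matI[where B = B]
        mat_eq_trans[OF mat_times_cong[OF mat_eq_sym[OF assms(2)] mat_eq_refl]]
        mat_eq_trans[OF mat_times_cong[OF mat_eq_refl mat_eq_sym[OF assms(2)]]])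
qed

section \<open>Isometry as an equivalence relation, and invariance of regularity\<close>

lemma isometric_cong:
  assumes "qdim q = qdim q'" "mat_eq (qdim q) (gram q) (gram q')" "square_mat R (qdim q) (gram q)"
  shows "isometric R q q'"
proof -
  let ?n = "qdim q"
  have sq: "square_mat R ?n (gram q')"
    using assms square_mat_mat_eq by blast
  \<comment> \<open>The identity matrix is the base change. With \<open>q'\<close> equal to
    \<open>q\<close> the lemma also serves as reflexivity of isometry.\<close>
  have "mat_eq ?n (mat_times R ?n (mat_transp (mat_id R)) (mat_times R ?n (gram q') (mat_id R)))
      (mat_times R ?n (mat_id R) (gram q'))"
    using sq by (intro mat_times_cong[OF _ mat_times_id(1)] square_mat_transp[OF square_mat_id]
        square_mat_times square_mat_id) (auto simp: mat_eq_def mat_id_def)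
  also have "mat_eq ?n \<dots> (gram q')"
    using sq by (intro mat_times_id)
  finally have "mat_eq ?n (gram q) (mat_times R ?n (mat_transp (mat_id R)) (mat_times R ?n (gram q') (mat_id R)))"
    using assms(2) by (simp add: mat_eq_def)
  then show ?thesis
    using assms(1) invertible_mat_id by (auto simp: isometric_def)
qed

text \<open>If \<open>D\<close> is the inverse of \<open>C\<close>, then \<open>A = C^T B C\<close>
  gives \<open>D^T A D = B\<close>. The assumption on \<open>gram q'\<close> is stated separately
  because \<open>isometric\<close> does not force Gram entries into the carrier.\<close>

lemma isometric_sym:
  assumes "isometric R q q'" "square_mat R (qdim q') (gram q')"
  shows "isometric R q' q"
proof -
  let ?n = "qdim q"
  let ?A = "gram q" and ?B = "gram q'"
  obtain C D where dim: "qdim q' = ?n" and sq: "square_mat R ?n C" "square_mat R ?n D"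
    and CD: "mat_eq ?n (mat_times R ?n C D) (mat_id R)" "mat_eq ?n (mat_times R ?n D C) (mat_id R)"
    and A: "mat_eq ?n ?A (mat_times R ?n (mat_transp C) (mat_times R ?n ?B C))"
    using assms(1) by (auto simp: isometric_def invertible_mat_def)
  have B: "square_mat R ?n ?B" using assms dim by simp
  have sqt: "square_mat R ?n (mat_transp C)" "square_mat R ?n (mat_transp D)"
    using sq by (simp_all add: square_mat_transp)
  have tt: "mat_eq ?n (mat_times R ?n (mat_transp D) (mat_transp C)) (mat_id R)"
  proof -
    have "mat_eq ?n (mat_transp (mat_times R ?n C D)) (mat_id R)"
      using CD(1) by (auto simp: mat_eq_def mat_id_def)
    then show ?thesis
      using transp_mat_times[OF sq] mat_eq_sym mat_eq_trans by blast
  qed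
  have "square_mat R ?n ?A"
    using A square_mat_mat_eq[OF _ mat_eq_sym] sq sqt B by (metis square_mat_times)
  then have "mat_eq ?n (mat_times R ?n (mat_transp D) (mat_times R ?n ?A D))
      (mat_times R ?n (mat_transp D) (mat_times R ?n (mat_times R ?n (mat_transp C) (mat_times R ?n ?B C)) D))"
    using A sq sqt by (intro mat_times_cong) auto
  also have "mat_eq ?n \<dots>
      (mat_times R ?n (mat_transp D) (mat_times R ?n (mat_transp C) (mat_times R ?n (mat_times R ?n ?B C) D)))"
    using sq sqt B by (intro mat_times_cong mat_times_assoc) auto
  also have "mat_eq ?n \<dots>
      (mat_times R ?n (mat_times R ?n (mat_transp D) (mat_transp C)) (mat_times R ?n (mat_times R ?n ?B C) D))"
    using sq sqt B by (intro mat_eq_sym[OF mat_times_assoc]) auto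
  also have "mat_eq ?n \<dots> (mat_times R ?n (mat_id R) (mat_times R ?n (mat_times R ?n ?B C) D))"
    using sq sqt B tt by (intro mat_times_cong) auto
  also have "mat_eq ?n \<dots> (mat_times R ?n (mat_times R ?n ?B C) D)"
    using sq B by (intro mat_times_id) auto
  also have "mat_eq ?n \<dots> (mat_times R ?n ?B (mat_times R ?n C D))"
    using sq B by (intro mat_times_assoc) auto
  also have "mat_eq ?n \<dots> (mat_times R ?n ?B (mat_id R))"
    using sq B CD by (intro mat_times_cong) auto
  also have "mat_eq ?n \<dots> ?B"
    using B by (intro mat_times_id) auto
  finally have "mat_eq ?n ?B (mat_times R ?n (mat_transp D) (mat_times R ?n ?A D))"
    by (rule mat_eq_sym)
  moreover have "invertible_mat R ?n D"
    using sq CD by (intro invertible_matI[where B = C])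
  ultimately show ?thesis
    using dim by (auto simp: isometric_def)
qed

text \<open>From \<open>A = C^T B C\<close> and \<open>B = D^T E D\<close> one gets
  \<open>A = (D C)^T E (D C)\<close>, so base changes compose.\<close>

lemma isometric_trans:
  assumes "isometric R q q'" "isometric R q' q''" "square_mat R (qdim q'') (gram q'')"
  shows "isometric R q q''"
proof -
  let ?n = "qdim q"
  let ?A = "gram q" and ?B = "gram q'" and ?E = "gram q''"
  obtain C where dim: "qdim q' = ?n" and C: "invertible_mat R ?n C"
    and A: "mat_eq ?n ?A (mat_times R ?n (mat_transp C) (mat_times R ?n ?B C))"
    using assms(1) by (auto simp: isometric_def)
  obtain D where dim': "qdim q'' = ?n" and D: "invertible_mat R ?n D"
    and B: "mat_eq ?n ?B (mat_times R ?n (mat_transp D) (mat_times R ?n ?E D))"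
    using assms(2) dim by (auto simp: isometric_def)
  have sq: "square_mat R ?n C" "square_mat R ?n D" "square_mat R ?n ?E"
    using C D assms(3) dim' by (auto simp: invertible_mat_def)
  have sqt: "square_mat R ?n (mat_transp C)" "square_mat R ?n (mat_transp D)"
    using sq by (simp_all add: square_mat_transp)
  have sqB: "square_mat R ?n ?B"
    using B square_mat_mat_eq[OF _ mat_eq_sym] sq sqt by (metis square_mat_times)
  note A
  also have "mat_eq ?n (mat_times R ?n (mat_transp C) (mat_times R ?n ?B C))
      (mat_times R ?n (mat_transp C) (mat_times R ?n (mat_times R ?n (mat_transp D) (mat_times R ?n ?E D)) C))"
    using B sqB sq sqt by (intro mat_times_cong) auto
  also have "mat_eq ?n \<dots>
      (mat_times R ?n (mat_transp C) (mat_times R ?n (mat_transp D) (mat_times R ?n (mat_times R ?n ?E D) C)))"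
    using sq sqt by (intro mat_times_cong mat_times_assoc) auto
  also have "mat_eq ?n \<dots>
      (mat_times R ?n (mat_times R ?n (mat_transp C) (mat_transp D)) (mat_times R ?n (mat_times R ?n ?E D) C))"
    using sq sqt by (intro mat_eq_sym[OF mat_times_assoc]) auto
  also have "mat_eq ?n \<dots>
      (mat_times R ?n (mat_transp (mat_times R ?n D C)) (mat_times R ?n ?E (mat_times R ?n D C)))"
    using sq sqt
    by (intro mat_times_cong[OF mat_eq_sym[OF transp_mat_times] mat_times_assoc] square_mat_times)
  finally show ?thesis
    using dim dim' invertible_mat_times[OF D C] by (auto simp: isometric_def)
qed

text \<open>\<open>C^T B C\<close> is a product of invertible matrices, and it is symmetric because
  \<open>B\<close> is. Regularity is carried from the second form to the first.\<close>

lemma regular_qform_isometric: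
  assumes "isometric R q q'" "regular_qform R q'"
  shows "regular_qform R q"
proof -
  let ?n = "qdim q"
  let ?A = "gram q" and ?B = "gram q'"
  obtain C where dim: "qdim q' = ?n" and C: "invertible_mat R ?n C"
    and A: "mat_eq ?n ?A (mat_times R ?n (mat_transp C) (mat_times R ?n ?B C))"
    using assms(1) by (auto simp: isometric_def)
  have B: "invertible_mat R ?n ?B" "mat_eq ?n (mat_transp ?B) ?B"
    using assms(2) dim by (auto simp: regular_qform_def mat_eq_def)
  have sq: "square_mat R ?n C" "square_mat R ?n ?B"
    using C B by (auto simp: invertible_mat_def)
  have sqt: "square_mat R ?n (mat_transp C)" "square_mat R ?n (mat_transp ?B)"
    using sq by (simp_all add: square_mat_transp)
  have inv: "invertible_mat R ?n ?A"
    by (rule invertible_mat_cong[OF invertible_mat_times[OF invertible_mat_transp[OF C]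
            invertible_mat_times[OF B(1) C]] mat_eq_sym[OF A]])
  have "mat_eq ?n (mat_transp ?A) (mat_transp (mat_times R ?n (mat_transp C) (mat_times R ?n ?B C)))"
    using A by (simp add: mat_eq_def)
  also have "mat_eq ?n \<dots> (mat_times R ?n (mat_transp (mat_times R ?n ?B C)) C)"
    by (rule transp_mat_times[OF sqt(1) square_mat_times[OF sq(2,1)]])
  also have "mat_eq ?n \<dots> (mat_times R ?n (mat_times R ?n (mat_transp C) (mat_transp ?B)) C)"
    by (rule mat_times_cong[OF transp_mat_times[OF sq(2,1)] mat_eq_refl
          square_mat_transp[OF square_mat_times[OF sq(2,1)]] sq(1)])
  also have "mat_eq ?n \<dots> (mat_times R ?n (mat_transp C) (mat_times R ?n (mat_transp ?B) C))"
    using sq sqt by (intro mat_times_assoc)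
  also have "mat_eq ?n \<dots> (mat_times R ?n (mat_transp C) (mat_times R ?n ?B C))"
    using sq sqt B by (intro mat_times_cong) auto
  also have "mat_eq ?n \<dots> ?A"
    using A by (rule mat_eq_sym)
  finally show ?thesis
    using inv by (simp add: regular_qform_def mat_eq_def)
qed

end

subsection \<open>Orthogonal sums\<close>

text \<open>The block pattern of \<open>orth_sum\<close>, separated from forms so that it also
  applies to base change matrices and inverses. Only the size of the first block is a parameter;
  that of the second comes from the context.\<close>

definition block_diag ::
  "('a, 'b) ring_scheme \<Rightarrow> nat \<Rightarrow> (nat \<Rightarrow> nat \<Rightarrow> 'a) \<Rightarrow> (nat \<Rightarrow> nat \<Rightarrow> 'a) \<Rightarrow> nat \<Rightarrow> nat \<Rightarrow> 'a" where
  "block_diag F n A B = (\<lambda>a b. if a < n \<and> b < n then A a b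
     else if n \<le> a \<and> n \<le> b then B (a - n) (b - n) else \<zero>\<^bsub>F\<^esub>)"

lemma qdim_orth_sum [simp]: "qdim (orth_sum F q q') = qdim q + qdim q'"
  by (simp add: orth_sum_def)

lemma gram_orth_sum [simp]:
  "gram (orth_sum F q q') = block_diag F (qdim q) (gram q) (gram q')"
  by (simp add: orth_sum_def block_diag_def)

lemma transp_block_diag:
  "mat_transp (block_diag F n A B) = block_diag F n (mat_transp A) (mat_transp B)"
  unfolding block_diag_def by (intro ext) (simp add: conj_commute)

lemma block_diag_id [simp]: "block_diag F n (mat_id F) (mat_id F) = mat_id F"
  by (auto simp: block_diag_def mat_id_def fun_eq_iff)

lemma block_diag_cong:
  "mat_eq n A A' \<Longrightarrow> mat_eq m B B' \<Longrightarrow> mat_eq (n + m) (block_diag F n A B) (block_diag F n A' B')"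
  by (auto simp: mat_eq_def block_diag_def)

text \<open>The entries agree at every pair of indices, so no isometry intervenes and the law can be
  used for rewriting.\<close>

lemma orth_sum_assoc: "orth_sum F (orth_sum F p q) t = orth_sum F p (orth_sum F q t)"
  by (simp add: orth_sum_def fun_eq_iff) linarith

context cring
begin

lemma square_mat_block_diag [simp]:
  "square_mat R n A \<Longrightarrow> square_mat R m B \<Longrightarrow> square_mat R (n + m) (block_diag R n A B)"
  by (auto simp: square_mat_def block_diag_def)

text \<open>The summation index is split at \<open>n\<close>; on each part the products vanish
  unless row and column both lie in the matching block.\<close>

lemma mat_times_block_diag:
  assumes "square_mat R n A" "square_mat R m B" "square_mat R n C" "square_mat R m D"
  shows "mat_eq (n + m) (mat_times R (n + m) (block_diag R n A B) (block_diag R n C D))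
    (block_diag R n (mat_times R n A C) (mat_times R m B D))"
  unfolding mat_eq_def
proof (intro allI impI)
  fix a b assume ab: "a < n + m" "b < n + m"
  let ?M = "block_diag R n A B" and ?N = "block_diag R n C D"
  have cl: "?M x y \<in> carrier R" "?N x y \<in> carrier R" if "x < n + m" "y < n + m" for x y
    using that square_mat_block_diag[OF assms(1,2)] square_mat_block_diag[OF assms(3,4)]
    by (simp_all add: square_mat_def)
  have "(\<Oplus>c\<in>{..<n}. ?M a c \<otimes> ?N c b)
      = (\<Oplus>c\<in>{..<n}. if a < n \<and> b < n then A a c \<otimes> C c b else \<zero>)"
    using ab assms by (intro finsum_cong') (auto simp: block_diag_def square_mat_def)
  also have "\<dots> = (if a < n \<and> b < n then mat_times R n A C a b else \<zero>)"
    by (cases "a < n"; cases "b < n") (simp_all add: mat_times_def)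
  finally have 1: "(\<Oplus>c\<in>{..<n}. ?M a c \<otimes> ?N c b)
      = (if a < n \<and> b < n then mat_times R n A C a b else \<zero>)" .
  have "(\<Oplus>c\<in>{..<m}. ?M a (n + c) \<otimes> ?N (n + c) b)
      = (\<Oplus>c\<in>{..<m}. if n \<le> a \<and> n \<le> b then B (a - n) c \<otimes> D c (b - n) else \<zero>)"
    using ab assms by (intro finsum_cong') (auto simp: block_diag_def square_mat_def)
  also have "\<dots> = (if n \<le> a \<and> n \<le> b then mat_times R m B D (a - n) (b - n) else \<zero>)"
    by (cases "n \<le> a"; cases "n \<le> b") (simp_all add: mat_times_def)
  finally have 2: "(\<Oplus>c\<in>{..<m}. ?M a (n + c) \<otimes> ?N (n + c) b)
      = (if n \<le> a \<and> n \<le> b then mat_times R m B D (a - n) (b - n) else \<zero>)" .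
  have cl': "mat_times R n A C a b \<in> carrier R" if "a < n" "b < n"
    using square_mat_times[OF assms(1,3)] that by (simp add: square_mat_def)
  have cl'': "mat_times R m B D (a - n) (b - n) \<in> carrier R" if "n \<le> a" "n \<le> b"
    using square_mat_times[OF assms(2,4)] that ab by (simp add: square_mat_def)
  have "mat_times R (n + m) ?M ?N a b
      = (if a < n \<and> b < n then mat_times R n A C a b else \<zero>)
        \<oplus> (if n \<le> a \<and> n \<le> b then mat_times R m B D (a - n) (b - n) else \<zero>)"
    unfolding mat_times_def[of R "n + m"] using ab cl
    by (subst finsum_add_index) (auto simp: 1 2)
  also have "\<dots> = block_diag R n (mat_times R n A C) (mat_times R m B D) a b"
    using cl' cl'' by (auto simp: block_diag_def)
  finally show "mat_times R (n + m) ?M ?N a b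
      = block_diag R n (mat_times R n A C) (mat_times R m B D) a b" .
qed

lemma invertible_block_diag:
  assumes "invertible_mat R n A" "invertible_mat R m B"
  shows "invertible_mat R (n + m) (block_diag R n A B)"
proof -
  obtain A' B' where sq: "square_mat R n A" "square_mat R m B" "square_mat R n A'" "square_mat R m B'"
    and A': "mat_eq n (mat_times R n A A') (mat_id R)" "mat_eq n (mat_times R n A' A) (mat_id R)"
    and B': "mat_eq m (mat_times R m B B') (mat_id R)" "mat_eq m (mat_times R m B' B) (mat_id R)"
    using assms by (auto simp: invertible_mat_def)
  have "mat_eq (n + m) (mat_times R (n + m) (block_diag R n A B) (block_diag R n A' B')) (mat_id R)"
    using mat_eq_trans[OF mat_times_block_diag[OF sq] block_diag_cong[OF A'(1) B'(1)]] by simp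
  moreover have "mat_eq (n + m) (mat_times R (n + m) (block_diag R n A' B') (block_diag R n A B)) (mat_id R)"
    using mat_eq_trans[OF mat_times_block_diag[OF sq(3,4,1,2)] block_diag_cong[OF A'(2) B'(2)]] by simp
  ultimately show ?thesis
    using sq by (intro invertible_matI) auto
qed

text \<open>The diagonal blocks of an inverse \<open>N\<close> of the whole matrix are inverses of
  \<open>A\<close> and \<open>B\<close>: the off-diagonal blocks of the block matrix are zero, so
  all mixed terms vanish.\<close>

lemma invertible_block_diagD:
  assumes "invertible_mat R (n + m) (block_diag R n A B)"
  shows "invertible_mat R n A" "invertible_mat R m B"
proof -
  let ?M = "block_diag R n A B"
  obtain N where M: "square_mat R (n + m) ?M" and N: "square_mat R (n + m) N"
    and MN: "mat_eq (n + m) (mat_times R (n + m) ?M N) (mat_id R)"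
      "mat_eq (n + m) (mat_times R (n + m) N ?M) (mat_id R)"
    using assms by (auto simp: invertible_mat_def)
  have clM: "?M a b \<in> carrier R" and clN: "N a b \<in> carrier R" if "a < n + m" "b < n + m" for a b
    using that M N by (auto simp: square_mat_def)
  have clA: "A a b \<in> carrier R" if "a < n" "b < n" for a b
    using clM[of a b] that by (simp add: block_diag_def)
  have clB: "B a b \<in> carrier R" if "a < m" "b < m" for a b
    using clM[of "n + a" "n + b"] that by (simp add: block_diag_def)
  have split: "mat_times R (n + m) X Y a b
      = (\<Oplus>c\<in>{..<n}. X a c \<otimes> Y c b) \<oplus> (\<Oplus>c\<in>{..<m}. X a (n + c) \<otimes> Y (n + c) b)"
    if "square_mat R (n + m) X" "square_mat R (n + m) Y" "a < n + m" "b < n + m" for X Y a b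
    using that unfolding mat_times_def by (intro finsum_add_index) (auto simp: square_mat_def)
  show "invertible_mat R n A"
  proof (rule invertible_matI)
    show "square_mat R n A" "square_mat R n N"
      using clA clN by (auto simp: square_mat_def)
    show "mat_eq n (mat_times R n A N) (mat_id R)"
      unfolding mat_eq_def
    proof (intro allI impI)
      fix a b assume ab: "a < n" "b < n"
      have "mat_times R (n + m) ?M N a b = mat_times R n A N a b \<oplus> (\<Oplus>c\<in>{..<m}. \<zero>)"
        unfolding split[OF M N trans_less_add1[OF ab(1)] trans_less_add1[OF ab(2)]]
          mat_times_def[of R n]
        using ab clA clN by (intro arg_cong2[of _ _ _ _ "(\<oplus>)"] finsum_cong') (auto simp: block_diag_def)
      also have "\<dots> = mat_times R n A N a b"
        using ab clA clN by (simp add: mat_times_def finsum_closed Pi_def)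
      finally show "mat_times R n A N a b = mat_id R a b"
        using MN ab by (simp add: mat_eq_def)
    qed
    show "mat_eq n (mat_times R n N A) (mat_id R)"
      unfolding mat_eq_def
    proof (intro allI impI)
      fix a b assume ab: "a < n" "b < n"
      have "mat_times R (n + m) N ?M a b = mat_times R n N A a b \<oplus> (\<Oplus>c\<in>{..<m}. \<zero>)"
        unfolding split[OF N M trans_less_add1[OF ab(1)] trans_less_add1[OF ab(2)]]
          mat_times_def[of R n]
        using ab clA clN by (intro arg_cong2[of _ _ _ _ "(\<oplus>)"] finsum_cong') (auto simp: block_diag_def)
      also have "\<dots> = mat_times R n N A a b"
        using ab clA clN by (simp add: mat_times_def finsum_closed Pi_def)
      finally show "mat_times R n N A a b = mat_id R a b"
        using MN ab by (simp add: mat_eq_def)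
    qed
  qed
  \<comment> \<open>The lower right block of \<open>N\<close>, reindexed from zero.\<close>
  let ?N = "\<lambda>a b. N (n + a) (n + b)"
  show "invertible_mat R m B"
  proof (rule invertible_matI)
    show "square_mat R m B" "square_mat R m ?N"
      using clB clN by (auto simp: square_mat_def)
    show "mat_eq m (mat_times R m B ?N) (mat_id R)"
      unfolding mat_eq_def
    proof (intro allI impI)
      fix a b assume ab: "a < m" "b < m"
      have "mat_times R (n + m) ?M N (n + a) (n + b) = (\<Oplus>c\<in>{..<n}. \<zero>) \<oplus> mat_times R m B ?N a b"
        unfolding split[OF M N add_strict_left_mono[OF ab(1)] add_strict_left_mono[OF ab(2)]]
          mat_times_def[of R m]
        using ab clB clN by (intro arg_cong2[of _ _ _ _ "(\<oplus>)"] finsum_cong') (auto simp: block_diag_def)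
      also have "\<dots> = mat_times R m B ?N a b"
        using ab clB clN by (simp add: mat_times_def finsum_closed Pi_def)
      finally show "mat_times R m B ?N a b = mat_id R a b"
        using MN ab by (simp add: mat_eq_def mat_id_def)
    qed
    show "mat_eq m (mat_times R m ?N B) (mat_id R)"
      unfolding mat_eq_def
    proof (intro allI impI)
      fix a b assume ab: "a < m" "b < m"
      have "mat_times R (n + m) N ?M (n + a) (n + b) = (\<Oplus>c\<in>{..<n}. \<zero>) \<oplus> mat_times R m ?N B a b"
        unfolding split[OF N M add_strict_left_mono[OF ab(1)] add_strict_left_mono[OF ab(2)]]
          mat_times_def[of R m]
        using ab clB clN by (intro arg_cong2[of _ _ _ _ "(\<oplus>)"] finsum_cong') (auto simp: block_diag_def)
      also have "\<dots> = mat_times R m ?N B a b"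
        using ab clB clN by (simp add: mat_times_def finsum_closed Pi_def)
      finally show "mat_times R m ?N B a b = mat_id R a b"
        using MN ab by (simp add: mat_eq_def mat_id_def)
    qed
  qed
qed

text \<open>The forward direction recovers the regularity of the summands after a form has been
  split.\<close>

lemma regular_orth_sum_iff:
  "regular_qform R (orth_sum R q t) \<longleftrightarrow> regular_qform R q \<and> regular_qform R t"
proof
  assume reg: "regular_qform R (orth_sum R q t)"
  let ?n = "qdim q" and ?M = "block_diag R (qdim q) (gram q) (gram t)"
  have sym: "?M a b = ?M b a" if "a < ?n + qdim t" "b < ?n + qdim t" for a b
    using reg that by (simp add: regular_qform_def)
  have "gram q a b = gram q b a" if "a < ?n" "b < ?n" for a b
    using sym[of a b] that by (simp add: block_diag_def)
  moreover have "gram t a b = gram t b a" if "a < qdim t" "b < qdim t" for a b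
    using sym[of "?n + a" "?n + b"] that by (simp add: block_diag_def)
  ultimately show "regular_qform R q \<and> regular_qform R t"
    using reg invertible_block_diagD[of ?n "qdim t" "gram q" "gram t"]
    by (simp add: regular_qform_def)
next
  assume reg: "regular_qform R q \<and> regular_qform R t"
  then have "block_diag R (qdim q) (gram q) (gram t) a b = block_diag R (qdim q) (gram q) (gram t) b a"
    if "a < qdim q + qdim t" "b < qdim q + qdim t" for a b
    using that by (auto simp: regular_qform_def block_diag_def)
  with reg show "regular_qform R (orth_sum R q t)"
    by (simp add: regular_qform_def invertible_block_diag)
qed

text \<open>Base changes \<open>C\<close> and \<open>D\<close> of the summands combine to their
  block matrix, whose transpose is again a block matrix.\<close>

lemma isometric_orth_sum:
  assumes "isometric R q q'" "isometric R t t'"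
    and "square_mat R (qdim q') (gram q')" "square_mat R (qdim t') (gram t')"
  shows "isometric R (orth_sum R q t) (orth_sum R q' t')"
proof -
  let ?n = "qdim q" and ?m = "qdim t"
  obtain C where dim: "qdim q' = ?n" and C: "invertible_mat R ?n C"
    and q: "mat_eq ?n (gram q) (mat_times R ?n (mat_transp C) (mat_times R ?n (gram q') C))"
    using assms(1) by (auto simp: isometric_def)
  obtain D where dim': "qdim t' = ?m" and D: "invertible_mat R ?m D"
    and t: "mat_eq ?m (gram t) (mat_times R ?m (mat_transp D) (mat_times R ?m (gram t') D))"
    using assms(2) by (auto simp: isometric_def)
  have sq: "square_mat R ?n C" "square_mat R ?m D" "square_mat R ?n (gram q')" "square_mat R ?m (gram t')"
    using C D assms dim dim' by (auto simp: invertible_mat_def)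
  have sqt: "square_mat R ?n (mat_transp C)" "square_mat R ?m (mat_transp D)"
    using sq by (simp_all add: square_mat_transp)
  let ?C = "block_diag R ?n C D"
  have "mat_eq (?n + ?m) (block_diag R ?n (gram q) (gram t))
      (block_diag R ?n (mat_times R ?n (mat_transp C) (mat_times R ?n (gram q') C))
        (mat_times R ?m (mat_transp D) (mat_times R ?m (gram t') D)))"
    by (rule block_diag_cong[OF q t])
  also have "mat_eq (?n + ?m) \<dots> (mat_times R (?n + ?m) (block_diag R ?n (mat_transp C) (mat_transp D))
      (block_diag R ?n (mat_times R ?n (gram q') C) (mat_times R ?m (gram t') D)))"
    by (rule mat_eq_sym[OF mat_times_block_diag[OF sqt square_mat_times[OF sq(3,1)] square_mat_times[OF sq(4,2)]]])
  also have "mat_eq (?n + ?m) \<dots> (mat_times R (?n + ?m) (block_diag R ?n (mat_transp C) (mat_transp D))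
      (mat_times R (?n + ?m) (block_diag R ?n (gram q') (gram t')) ?C))"
    using sq sqt by (intro mat_times_cong mat_eq_refl mat_eq_sym[OF mat_times_block_diag]
        square_mat_block_diag square_mat_times)
  finally have "mat_eq (?n + ?m) (block_diag R ?n (gram q) (gram t))
      (mat_times R (?n + ?m) (mat_transp ?C)
        (mat_times R (?n + ?m) (block_diag R ?n (gram q') (gram t')) ?C))"
    unfolding transp_block_diag .
  then show ?thesis
    using dim dim' invertible_block_diag[OF C D] by (auto simp: isometric_def)
qed

text \<open>The basis change adds \<open>t b\<close> times the \<open>k\<close>-th basis vector to the \<open>b\<close>-th one.\<close>

lemma isometric_elementary:
  assumes A: "square_mat R n A" and k: "k < n" and t: "\<And>b. t b \<in> carrier R" and tk: "t k = \<zero>"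
  shows "isometric R (QForm n (\<lambda>a b. A a b \<oplus> A a k \<otimes> t b \<oplus> (A k b \<oplus> A k k \<otimes> t b) \<otimes> t a)) (QForm n A)"
proof -
  \<comment> \<open>\<open>E s\<close> is the identity with \<open>s\<close> added to row
    \<open>k\<close>; its column \<open>b\<close> is the new basis vector
    \<open>e_b + s b e_k\<close>.\<close>
  define E where "E s = (\<lambda>a b. mat_id R a b \<oplus> (if a = k then s b else \<zero>))" for s
  have sqE: "square_mat R n (E s)" if "\<And>b. s b \<in> carrier R" for s
    using that by (simp add: square_mat_def E_def mat_id_def)
  have mult: "mat_times R n X (E s) a b = X a b \<oplus> X a k \<otimes> s b"
    if X: "square_mat R n X" and s: "\<And>b. s b \<in> carrier R" and ab: "a < n" "b < n" for X s a b
  proof -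
    have cl: "X a c \<in> carrier R" if "c < n" for c
      using X ab that by (simp add: square_mat_def)
    have "mat_times R n X (E s) a b
        = (\<Oplus>c\<in>{..<n}. X a c \<otimes> (if c = b then \<one> else \<zero>) \<oplus> X a c \<otimes> (if c = k then s b else \<zero>))"
      unfolding mat_times_def E_def mat_id_def
      using cl s by (intro finsum_cong') (auto simp: r_distr)
    also have "\<dots> = (\<Oplus>c\<in>{..<n}. X a c \<otimes> (if c = b then \<one> else \<zero>))
        \<oplus> (\<Oplus>c\<in>{..<n}. X a c \<otimes> (if c = k then s b else \<zero>))"
      using cl s by (intro finsum_addf) auto
    also have "\<dots> = X a b \<oplus> X a k \<otimes> s b"
      using cl s ab k finsum_delta[of b n "X a" \<one>] finsum_delta[of k n "X a" "s b"] by simp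
    finally show ?thesis .
  qed
  \<comment> \<open>Since \<open>s k = 0\<close>, the entry of \<open>E s\<close> at
    \<open>k, k\<close> is one, and multiplying by the matrix of \<open>- s\<close> cancels the
    added row exactly.\<close>
  have inv: "mat_eq n (mat_times R n (E s) (E s')) (mat_id R)"
    if "\<And>b. s b \<in> carrier R" "\<And>b. s' b = \<ominus> s b" "s k = \<zero>" for s s'
  proof -
    have "mat_id R a b \<oplus> (if a = k then s b else \<zero>) \<oplus> (mat_id R a k \<oplus> (if a = k then s k else \<zero>)) \<otimes> s' b
        = mat_id R a b" for a b
    proof (cases "a = k")
      case True
      have "mat_id R a b \<in> carrier R" by (simp add: mat_id_def)
      then show ?thesis
        using that True by (simp add: mat_id_def[of R, THEN fun_cong, THEN fun_cong, of k k] a_assoc r_neg)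
    next
      case False
      then show ?thesis using that by (simp add: mat_id_def)
    qed
    then show ?thesis
      using that mult[of "E s" s'] sqE[of s] unfolding mat_eq_def by (simp add: E_def)
  qed
  have Einv: "invertible_mat R n (E t)"
    by (rule invertible_matI[of _ _ "E (\<lambda>b. \<ominus> t b)"]) (use t tk in \<open>auto intro!: sqE inv\<close>)
  have "mat_times R n (mat_transp (E t)) (mat_times R n A (E t)) a b
      = A a b \<oplus> A a k \<otimes> t b \<oplus> (A k b \<oplus> A k k \<otimes> t b) \<otimes> t a" if ab: "a < n" "b < n" for a b
  proof -
    let ?P = "mat_times R n A (E t)"
    have P: "square_mat R n ?P" using A sqE t by simp
    \<comment> \<open>Left multiplication by \<open>E t\<close> transposed becomes, after exchanging
      the indices, right multiplication by \<open>E t\<close>, so \<open>mult\<close> applies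
      again.\<close>
    have "mat_times R n (mat_transp (E t)) ?P a b = mat_times R n (mat_transp ?P) (E t) b a"
      using P sqE[of t] t ab unfolding mat_times_def[of R n "mat_transp _"] square_mat_def
      by (intro finsum_cong') (auto simp: m_comm)
    also have "\<dots> = ?P a b \<oplus> ?P k b \<otimes> t a"
      by (rule mult[OF square_mat_transp[OF P] t ab(2,1)])
    also have "\<dots> = A a b \<oplus> A a k \<otimes> t b \<oplus> (A k b \<oplus> A k k \<otimes> t b) \<otimes> t a"
      using ab k t A by (simp add: mult)
    finally show ?thesis .
  qed
  then show ?thesis
    using Einv unfolding isometric_def by (intro conjI exI[of _ "E t"]) (auto simp: mat_eq_def)
qed

end

section \<open>Splitting off one-dimensional forms\<close>

context field
begin

text \<open>If the last diagonal entry vanishes, one of \<open>e\<^sub>n + e\<^sub>k\<close> and \<open>e\<^sub>n - e\<^sub>k\<close> is anisotropic for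
  any \<open>k\<close> with \<open>e\<^sub>k\<close> not orthogonal to \<open>e\<^sub>n\<close>.\<close>

lemma regular_qform_anisotropic_last:
  assumes two: "\<one> \<oplus> \<one> \<noteq> \<zero>" and reg: "regular_qform R \<sigma>" and dim: "qdim \<sigma> = Suc n"
  obtains \<rho> where "isometric R \<rho> \<sigma>" "qdim \<rho> = Suc n" "gram \<rho> n n \<noteq> \<zero>"
proof -
  obtain A where \<sigma>: "\<sigma> = QForm (Suc n) A" using dim by (cases \<sigma>) auto
  have sq: "square_mat R (Suc n) A" and sym: "\<And>a b. a < Suc n \<Longrightarrow> b < Suc n \<Longrightarrow> A a b = A b a"
    using reg \<sigma> by (auto simp: regular_qform_def invertible_mat_def)
  have cl: "A a b \<in> carrier R" if "a < Suc n" "b < Suc n" for a b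
    using sq that by (simp add: square_mat_def)
  show thesis
  proof (cases "A n n = \<zero>")
    case False
    then show thesis
      using that[of \<sigma>] isometric_cong[of \<sigma> \<sigma>] sq \<sigma> by simp
  next
    case True
    obtain N where N: "square_mat R (Suc n) N" "mat_eq (Suc n) (mat_times R (Suc n) A N) (mat_id R)"
      using reg \<sigma> by (auto simp: regular_qform_def invertible_mat_def)
    \<comment> \<open>If the last row of \<open>A\<close> were zero, so would be that of
      \<open>A N\<close>, whose entry at \<open>n, n\<close> is one.\<close>
    have "\<exists>k<Suc n. A n k \<noteq> \<zero>"
    proof (rule ccontr)
      assume "\<not> (\<exists>k<Suc n. A n k \<noteq> \<zero>)"
      then have "mat_times R (Suc n) A N n n = (\<Oplus>c\<in>{..<Suc n}. \<zero>)"
        unfolding mat_times_def using N(1) by (intro finsum_cong') (auto simp: square_mat_def)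
      then show False
        using N(2) by (simp add: mat_eq_def mat_id_def del: finsum_Suc)
    qed
    then obtain k where k: "k < n" "A n k \<noteq> \<zero>"
      using True less_Suc_eq by auto
    define x y where "x = A n k" and "y = A k k"
    have xy: "x \<in> carrier R" "y \<in> carrier R" "A k n = x"
      using k cl sym by (auto simp: x_def y_def)
    \<comment> \<open>This choice replaces the last basis vector by \<open>e_n + c e_k\<close> and
      keeps the others.\<close>
    define t where "t c b = (if b = n then c else \<zero>)" for c b
    define B where
      "B c = (\<lambda>a b. A a b \<oplus> A a k \<otimes> t c b \<oplus> (A k b \<oplus> A k k \<otimes> t c b) \<otimes> t c a)" for c
    have iso: "isometric R (QForm (Suc n) (B c)) \<sigma>" if "c \<in> carrier R" for c
      unfolding B_def \<sigma> using that k sq by (intro isometric_elementary) (auto simp: t_def)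
    \<comment> \<open>The value of the form at \<open>e_n + c e_k\<close> is
      \<open>2 c x + c^2 y\<close>, because \<open>A n n\<close> is zero.\<close>
    have Bnn: "B c n n = x \<otimes> c \<oplus> (x \<oplus> y \<otimes> c) \<otimes> c" if "c \<in> carrier R" for c
      using that xy True by (simp add: B_def t_def x_def[symmetric] y_def[symmetric])
    have "B \<one> n n \<noteq> \<zero> \<or> B (\<ominus> \<one>) n n \<noteq> \<zero>"
    proof (rule ccontr)
      assume "\<not> ?thesis"
      then have 0: "x \<oplus> (x \<oplus> y) = \<zero>" "\<ominus> x \<oplus> (\<ominus> x \<oplus> y) = \<zero>"
        using xy by (simp_all add: Bnn l_minus r_minus l_distr minus_add)
      \<comment> \<open>Subtracting the two vanishing values \<open>2 x + y\<close> and
        \<open>y - 2 x\<close> leaves \<open>4 x\<close>, and 4 is nonzero in a field where 2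
        is.\<close>
      have "(\<one> \<oplus> \<one>) \<otimes> ((\<one> \<oplus> \<one>) \<otimes> x) = (x \<oplus> (x \<oplus> y)) \<ominus> (\<ominus> x \<oplus> (\<ominus> x \<oplus> y))"
        using xy by algebra
      also have "\<dots> = \<zero>" using 0 by (simp add: minus_eq)
      finally have "x = \<zero>" using two xy integral_iff by simp
      then show False using k x_def by simp
    qed
    then show thesis
      using that[of "QForm (Suc n) (B \<one>)"] that[of "QForm (Suc n) (B (\<ominus> \<one>))"] iso by auto
  qed
qed

text \<open>One step of Gram-Schmidt: once the last basis vector is anisotropic, subtracting
  projections onto it makes the others orthogonal to it, and the form splits.\<close>

lemma regular_qform_split_last:
  assumes two: "\<one> \<oplus> \<one> \<noteq> \<zero>" and reg: "regular_qform R \<sigma>" and dim: "qdim \<sigma> = Suc n"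
  obtains \<rho> \<tau> where "regular_qform R \<rho>" "regular_qform R \<tau>" "qdim \<rho> = n" "qdim \<tau> = 1"
    "isometric R \<sigma> (orth_sum R \<rho> \<tau>)"
proof -
  obtain B where iso: "isometric R (QForm (Suc n) B) \<sigma>" and Bnn: "B n n \<noteq> \<zero>"
    using regular_qform_anisotropic_last[OF assms] by (metis qform.collapse qform.sel(2))
  have regB: "regular_qform R (QForm (Suc n) B)"
    using regular_qform_isometric[OF iso reg] .
  have sq: "square_mat R (Suc n) B" and sym: "\<And>a b. a < Suc n \<Longrightarrow> b < Suc n \<Longrightarrow> B a b = B b a"
    using regB by (auto simp: regular_qform_def invertible_mat_def)
  have cl: "B a b \<in> carrier R" if "a < Suc n" "b < Suc n" for a b
    using sq that by (simp add: square_mat_def)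
  have un: "B n n \<in> Units R" using Bnn cl by (simp add: field_Units)
  \<comment> \<open>The negated coefficient of the projection onto the last basis vector; at
    \<open>n\<close> it is zero, as \<open>isometric_elementary\<close> demands, so that this vector
    stays unchanged.\<close>
  define t where "t b = (if b < n then \<ominus> (B n b \<otimes> inv (B n n)) else \<zero>)" for b
  define D where "D = (\<lambda>a b. B a b \<oplus> B a n \<otimes> t b \<oplus> (B n b \<oplus> B n n \<otimes> t b) \<otimes> t a)"
  have t: "t b \<in> carrier R" for b using un cl by (simp add: t_def)
  have isoD: "isometric R (QForm (Suc n) D) (QForm (Suc n) B)"
    unfolding D_def using sq t by (intro isometric_elementary) (auto simp: t_def)
  have regD: "regular_qform R (QForm (Suc n) D)"
    using regular_qform_isometric[OF isoD regB] .
  have sqD: "square_mat R (Suc n) D" and symD: "\<And>a b. a < Suc n \<Longrightarrow> b < Suc n \<Longrightarrow> D a b = D b a"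
    using regD by (auto simp: regular_qform_def invertible_mat_def)
  have D0: "D n b = \<zero>" if "b < n" for b
  proof -
    have "B n n \<otimes> t b = \<ominus> (B n b \<otimes> (B n n \<otimes> inv (B n n)))"
      using un cl that by (simp add: t_def r_minus m_lcomm del: Units_r_inv)
    also have "\<dots> = \<ominus> B n b" using un cl that by simp
    finally have "B n n \<otimes> t b = \<ominus> B n b" .
    then show ?thesis using that cl t by (simp add: D_def r_neg)
  qed
  define \<rho> \<tau> where "\<rho> = QForm n D" and "\<tau> = QForm 1 (\<lambda>_ _. D n n)"
  have eq: "mat_eq (Suc n) D (block_diag R n D (\<lambda>_ _. D n n))"
    using D0 symD by (auto simp: mat_eq_def block_diag_def less_Suc_eq)
  have iso1: "isometric R (QForm (Suc n) D) (orth_sum R \<rho> \<tau>)"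
    using eq sqD by (intro isometric_cong) (auto simp: \<rho>_def \<tau>_def)
  have sqs: "square_mat R (Suc n) (block_diag R n D (\<lambda>_ _. D n n))"
    using square_mat_mat_eq[OF sqD eq] .
  \<comment> \<open>Turned around because \<open>regular_qform_isometric\<close> carries regularity
    from the second form to the first.\<close>
  then have iso2: "isometric R (orth_sum R \<rho> \<tau>) (QForm (Suc n) D)"
    using isometric_sym[OF iso1] by (simp add: \<rho>_def \<tau>_def)
  have "regular_qform R (orth_sum R \<rho> \<tau>)"
    using regular_qform_isometric[OF iso2 regD] .
  moreover have "isometric R \<sigma> (orth_sum R \<rho> \<tau>)"
  proof -
    have "square_mat R (Suc n) (gram \<sigma>)"
      using reg dim by (simp add: regular_qform_def invertible_mat_def)
    then have "isometric R \<sigma> (QForm (Suc n) B)"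
      using isometric_sym[OF iso] dim by simp
    moreover have "isometric R (QForm (Suc n) B) (QForm (Suc n) D)"
      using isometric_sym[OF isoD] sq by simp
    ultimately show ?thesis
      using isometric_trans[OF isometric_trans iso1] sqD sqs by (simp add: \<rho>_def \<tau>_def)
  qed
  ultimately show thesis
    using that[of \<rho> \<tau>] by (simp add: regular_orth_sum_iff \<rho>_def \<tau>_def)
qed

end

subsection \<open>Witt index\<close>

text \<open>The set whose maximum is the Witt index, named so that inclusions and finiteness can be
  stated for it.\<close>

definition witt_decompositions :: "('a, 'b) ring_scheme \<Rightarrow> 'a qform \<Rightarrow> nat set" where
  "witt_decompositions F q =
     {m. \<exists>q'. regular_qform F q' \<and> isometric F q (orth_sum F (hyperbolic_form F m) q')}"

lemma witt_index_Max: "witt_index F q = Max (witt_decompositions F q)"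
  by (simp add: witt_index_def witt_decompositions_def)

lemma qdim_hyperbolic_form [simp]: "qdim (hyperbolic_form F m) = 2 * m"
  by (induction m) (simp_all add: hyperbolic_plane_def)

lemma witt_decompositions_le: "m \<in> witt_decompositions F q \<Longrightarrow> 2 * m \<le> qdim q"
  by (auto simp: witt_decompositions_def isometric_def)

lemma finite_witt_decompositions: "finite (witt_decompositions F q)"
  by (rule finite_subset[of _ "{..qdim q}"]) (auto dest: witt_decompositions_le)

lemma regular_qform_square: "regular_qform F q \<Longrightarrow> square_mat F (qdim q) (gram q)"
  by (simp add: regular_qform_def invertible_mat_def)

context cring
begin

lemma square_mat_hyperbolic_form: "square_mat R (2 * m) (gram (hyperbolic_form R m))"
proof (induction m)
  case (Suc m)
  have "square_mat R 2 (gram (hyperbolic_plane R))"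
    by (simp add: square_mat_def hyperbolic_plane_def)
  then show ?case
    using square_mat_block_diag[OF _ Suc, of 2] by (simp add: hyperbolic_plane_def)
qed (simp add: square_mat_def)

lemma square_mat_witt_decomposition:
  assumes "regular_qform R q'"
  shows "square_mat R (2 * m + qdim q') (gram (orth_sum R (hyperbolic_form R m) q'))"
  using square_mat_block_diag[OF square_mat_hyperbolic_form regular_qform_square[OF assms]] by simp

text \<open>The set must be nonempty for its \<open>Max\<close> to be meaningful; the empty
  hyperbolic part with \<open>q\<close> itself as complement provides an element.\<close>

lemma zero_in_witt_decompositions:
  assumes "regular_qform R q"
  shows "0 \<in> witt_decompositions R q"
proof -
  have "isometric R q (orth_sum R (hyperbolic_form R 0) q)"
    using regular_qform_square[OF assms] by (intro isometric_cong) (auto simp: mat_eq_def block_diag_def)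
  then show ?thesis
    using assms by (auto simp: witt_decompositions_def)
qed

lemma witt_index_mono:
  assumes "regular_qform R q" "witt_decompositions R q \<subseteq> witt_decompositions R p"
  shows "witt_index R q \<le> witt_index R p"
  unfolding witt_index_Max using assms zero_in_witt_decompositions
  by (intro Max_mono finite_witt_decompositions) auto

text \<open>By transitivity, an isometry from \<open>p\<close> to \<open>q\<close> turns every
  decomposition of \<open>q\<close> into one of \<open>p\<close>.\<close>

lemma witt_index_isometric_le:
  assumes "isometric R p q" "regular_qform R q"
  shows "witt_index R q \<le> witt_index R p"
proof (rule witt_index_mono[OF assms(2)])
  show "witt_decompositions R q \<subseteq> witt_decompositions R p"
    using isometric_trans[OF assms(1)] square_mat_witt_decomposition
    by (auto simp: witt_decompositions_def simp del: gram_orth_sum)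
qed

text \<open>The summand \<tau> is absorbed into the complement of the hyperbolic part, by
  associativity of \<open>orth_sum\<close>.\<close>

lemma witt_index_orth_sum_ge:
  assumes "regular_qform R q" "regular_qform R \<tau>"
  shows "witt_index R q \<le> witt_index R (orth_sum R q \<tau>)"
proof (rule witt_index_mono[OF assms(1)], rule subsetI)
  fix m assume "m \<in> witt_decompositions R q"
  then obtain q' where q': "regular_qform R q'"
    and iso: "isometric R q (orth_sum R (hyperbolic_form R m) q')"
    by (auto simp: witt_decompositions_def)
  have "isometric R \<tau> \<tau>"
    using regular_qform_square[OF assms(2)] by (intro isometric_cong) auto
  then have "isometric R (orth_sum R q \<tau>) (orth_sum R (orth_sum R (hyperbolic_form R m) q') \<tau>)"
    using iso square_mat_witt_decomposition[OF q'] regular_qform_square[OF assms(2)]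
    by (intro isometric_orth_sum) auto
  then show "m \<in> witt_decompositions R (orth_sum R q \<tau>)"
    unfolding orth_sum_assoc witt_decompositions_def using q' assms(2)
    by (intro CollectI exI[of _ "orth_sum R q' \<tau>"]) (simp add: regular_orth_sum_iff)
qed

end

section \<open>Enlarging forms below the invariant\<close>

context field
begin

text \<open>One-dimensional summands are split off \<sigma> until dimension \<open>n\<close> is
  reached, and dropping a summand cannot raise the Witt index. This takes the place of a full
  diagonalisation.\<close>

lemma regular_qform_sub:
  assumes two: "\<one> \<oplus> \<one> \<noteq> \<zero>" and "regular_qform R q" "regular_qform R \<sigma>" "n \<le> qdim \<sigma>"
  obtains \<rho> where "regular_qform R \<rho>" "qdim \<rho> = n"
    "witt_index R (orth_sum R q \<rho>) \<le> witt_index R (orth_sum R q \<sigma>)"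
proof -
  have "\<exists>\<rho>. regular_qform R \<rho> \<and> qdim \<rho> = n
      \<and> witt_index R (orth_sum R q \<rho>) \<le> witt_index R (orth_sum R q \<sigma>)"
    using assms(3,4)
  proof (induction "qdim \<sigma> - n" arbitrary: \<sigma>)
    case 0
    then show ?case by auto
  next
    case (Suc d)
    then obtain k where k: "qdim \<sigma> = Suc k" by (cases "qdim \<sigma>") auto
    obtain \<rho> \<tau> where \<rho>\<tau>: "regular_qform R \<rho>" "regular_qform R \<tau>" "qdim \<rho> = k"
      "isometric R \<sigma> (orth_sum R \<rho> \<tau>)"
      using regular_qform_split_last[OF two Suc.prems(1) k] by metis
    have reg: "regular_qform R (orth_sum R \<rho> \<tau>)"
      using \<rho>\<tau> by (simp add: regular_orth_sum_iff)
    have "witt_index R (orth_sum R q \<rho>) \<le> witt_index R (orth_sum R (orth_sum R q \<rho>) \<tau>)"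
      using \<rho>\<tau> assms(2) by (intro witt_index_orth_sum_ge) (auto simp: regular_orth_sum_iff)
    also have "\<dots> \<le> witt_index R (orth_sum R q \<sigma>)"
      unfolding orth_sum_assoc
      using \<rho>\<tau>(4) reg assms(2) isometric_cong[of q q]
      by (intro witt_index_isometric_le isometric_orth_sum)
        (auto simp: regular_orth_sum_iff simp del: gram_orth_sum qdim_orth_sum intro!: regular_qform_square)
    finally show ?case
      using Suc.hyps(1)[of \<rho>] Suc.hyps(2) Suc.prems \<rho>\<tau> k by (fastforce intro: order_trans)
  qed
  then show thesis using that by blast
qed

text \<open>The dimension of \<open>q\<close> is below the infimum, so some condition in the
  definition of \<open>m_invariant\<close> fails for \<open>q\<close>, and only the one on \<sigma>
  can. The resulting \<sigma> is then shrunk to dimension \<open>n\<close>.\<close>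

lemma regular_qform_extend:
  assumes two: "\<one> \<oplus> \<one> \<noteq> \<zero>" and q: "regular_qform R q" "1 \<le> qdim q" "witt_index R q < j"
    and m: "enat (qdim q) < m_invariant R i j" and n: "n \<le> i"
  obtains \<rho> where "regular_qform R \<rho>" "qdim \<rho> = n" "witt_index R (orth_sum R q \<rho>) < j"
proof -
  have "\<exists>\<sigma>. regular_qform R \<sigma> \<and> qdim \<sigma> = i \<and> witt_index R (orth_sum R q \<sigma>) < j"
  proof (rule ccontr)
    assume "\<not> ?thesis"
    then have "m_invariant R i j \<le> enat (qdim q)"
      unfolding m_invariant_def using q by (intro Inf_lower) (auto simp: not_less)
    then show False using m by simp
  qed
  then obtain \<sigma> where \<sigma>: "regular_qform R \<sigma>" "qdim \<sigma> = i" "witt_index R (orth_sum R q \<sigma>) < j"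
    by blast
  with regular_qform_sub[OF two q(1) \<sigma>(1), of n] n that show thesis
    by (metis order_le_less_trans)
qed

text \<open>The target is \<open>(m - 1) + s\<close>: dimension \<open>m - 1\<close> is the last at
  which \<open>regular_qform_extend\<close> applies, and from there \<open>s\<close> dimensions are
  added in one go, which \<open>s \<le> i\<close> permits.\<close>

lemma regular_qform_extend_to:
  assumes two: "\<one> \<oplus> \<one> \<noteq> \<zero>" and q: "regular_qform R q" "1 \<le> qdim q" "witt_index R q < j"
    and m: "m_invariant R i j = enat m" "qdim q < m" and s: "1 \<le> i" "s \<le> i"
  obtains \<rho> where "regular_qform R \<rho>" "qdim q + qdim \<rho> = m + s - 1"
    "witt_index R (orth_sum R q \<rho>) < j"
proof -
  have "\<exists>\<rho>. regular_qform R \<rho> \<and> qdim q + qdim \<rho> = m + s - 1 \<and> witt_index R (orth_sum R q \<rho>) < j"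
    using q m(2)
  \<comment> \<open>Gap zero contradicts \<open>qdim q < m\<close>; dimension \<open>m - 1\<close>
    is gap one, that is, \<open>d = 0\<close>.\<close>
  proof (induction "m - qdim q" arbitrary: q)
    case (Suc d)
    show ?case
    proof (cases d)
      case 0
      obtain \<rho> where "regular_qform R \<rho>" "qdim \<rho> = s" "witt_index R (orth_sum R q \<rho>) < j"
        using regular_qform_extend[OF two Suc.prems(1-3) _ s(2)] m(1) Suc.prems(4) by auto
      then show ?thesis using 0 Suc.hyps(2) Suc.prems(4) by (intro exI[of _ \<rho>]) auto
    next
      \<comment> \<open>With gap at least two, one more dimension stays below \<open>m\<close>, so
        the induction hypothesis applies; its summand is merged with \<tau> by
        associativity.\<close>
      case (Suc d')
      obtain \<tau> where \<tau>: "regular_qform R \<tau>" "qdim \<tau> = 1" "witt_index R (orth_sum R q \<tau>) < j"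
        using regular_qform_extend[OF two Suc.prems(1-3) _ s(1)] m(1) Suc.prems(4) by auto
      have "\<exists>\<rho>. regular_qform R \<rho> \<and> qdim (orth_sum R q \<tau>) + qdim \<rho> = m + s - 1
          \<and> witt_index R (orth_sum R (orth_sum R q \<tau>) \<rho>) < j"
        using \<tau> Suc Suc.hyps(2) Suc.prems by (intro Suc.hyps(1)) (auto simp: regular_orth_sum_iff)
      then obtain \<rho> where "regular_qform R \<rho>" "qdim (orth_sum R q \<tau>) + qdim \<rho> = m + s - 1"
          "witt_index R (orth_sum R q (orth_sum R \<tau> \<rho>)) < j"
        unfolding orth_sum_assoc by blast
      then show ?thesis
        using \<tau>(1) by (intro exI[of _ "orth_sum R \<tau> \<rho>"]) (auto simp: regular_orth_sum_iff)
    qed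
  qed simp
  then show thesis using that by blast
qed

end

subsection \<open>Scalar extension and completions\<close>

context ring_hom_cring
begin

text \<open>A ring homomorphism respects finite sums of products, so the image of the inverse is an
  inverse of the image.\<close>

lemma invertible_mat_hom:
  assumes "invertible_mat R n A"
  shows "invertible_mat S n (\<lambda>a b. h (A a b))"
proof -
  obtain B where sq: "square_mat R n A" "square_mat R n B"
    and AB: "mat_eq n (mat_times R n A B) (mat_id R)" "mat_eq n (mat_times R n B A) (mat_id R)"
    using assms by (auto simp: invertible_mat_def)
  have "mat_eq n (mat_times S n (\<lambda>a b. h (X a b)) (\<lambda>a b. h (Y a b))) (mat_id S)"
    if "square_mat R n X" "square_mat R n Y" "mat_eq n (mat_times R n X Y) (mat_id R)" for X Y
    unfolding mat_eq_def
  proof (intro allI impI)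
    fix a b assume ab: "a < n" "b < n"
    have "mat_times S n (\<lambda>a b. h (X a b)) (\<lambda>a b. h (Y a b)) a b
        = (\<Oplus>\<^bsub>S\<^esub>c\<in>{..<n}. h (X a c \<otimes> Y c b))"
      unfolding mat_times_def using that ab by (intro S.finsum_cong') (auto simp: square_mat_def)
    also have "\<dots> = h (mat_times R n X Y a b)"
      unfolding mat_times_def using that ab
      by (subst hom_finsum) (auto simp: square_mat_def comp_def)
    also have "\<dots> = mat_id S a b"
      using that(3) ab by (simp add: mat_eq_def mat_id_def)
    finally show "mat_times S n (\<lambda>a b. h (X a b)) (\<lambda>a b. h (Y a b)) a b = mat_id S a b" .
  qed
  then show ?thesis
    using sq AB by (intro S.invertible_matI[where B = "\<lambda>a b. h (B a b)"]) (auto simp: square_mat_def)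
qed

lemma regular_qform_hom:
  assumes "regular_qform R q"
  shows "regular_qform S (QForm (qdim q) (\<lambda>a b. h (gram q a b)))"
  using assms invertible_mat_hom by (auto simp: regular_qform_def)

end

section \<open>Valuations and Cauchy sequences\<close>

locale valued_field = field K for K (structure) +
  fixes v :: "'a \<Rightarrow> int extended"
  assumes valuation: "discrete_valuation K v"
begin

lemma v_zero [simp]: "v \<zero> = \<infinity>"
  and v_Fin: "x \<in> carrier K \<Longrightarrow> x \<noteq> \<zero> \<Longrightarrow> v x \<in> range Fin"
  and v_mult: "x \<in> carrier K \<Longrightarrow> y \<in> carrier K \<Longrightarrow> v (x \<otimes> y) = v x + v y"
  and v_add: "x \<in> carrier K \<Longrightarrow> y \<in> carrier K \<Longrightarrow> min (v x) (v y) \<le> v (x \<oplus> y)"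
  using valuation by (auto simp: discrete_valuation_def)

lemma v_lower: "x \<in> carrier K \<Longrightarrow> \<exists>N. Fin N \<le> v x"
  using v_Fin[of x] by (cases "x = \<zero>") auto

text \<open>The value of 1 is zero, and twice the value of -1 is the value of 1; hence -1 has value
  zero, the integers being torsion-free.\<close>

lemma v_neg:
  assumes "x \<in> carrier K"
  shows "v (\<ominus> x) = v x"
proof -
  obtain p where p: "v (\<ominus> \<one>) = Fin p" using v_Fin[of "\<ominus> \<one>"] by auto
  obtain u where u: "v \<one> = Fin u" using v_Fin[of \<one>] by auto
  have "v \<one> + v \<one> = v \<one>" using v_mult[of \<one> \<one>] by simp
  moreover have "v (\<ominus> \<one>) + v (\<ominus> \<one>) = v \<one>"
    using v_mult[of "\<ominus> \<one>" "\<ominus> \<one>"] by (simp add: l_minus)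
  ultimately have "p = 0" using p u by simp
  moreover have "v (\<ominus> x) = v (\<ominus> \<one>) + v x"
    using v_mult[of "\<ominus> \<one>" x] assms by (simp add: l_minus)
  ultimately show ?thesis
    using p by (simp add: zero_extended_def[symmetric])
qed

lemma v_add_ge:
  "x \<in> carrier K \<Longrightarrow> y \<in> carrier K \<Longrightarrow> Fin N \<le> v x \<Longrightarrow> Fin N \<le> v y \<Longrightarrow> Fin N \<le> v (x \<oplus> y)"
  using v_add[of x y] by (meson min.boundedI order_trans)

lemma v_mult_ge:
  assumes "x \<in> carrier K" "y \<in> carrier K" "Fin M \<le> v x" "Fin N \<le> v y"
  shows "Fin (M + N) \<le> v (x \<otimes> y)"
  using add_mono[OF assms(3,4)] v_mult[OF assms(1,2)] by simp

lemma cauchy_seqs_closed: "x \<in> cauchy_seqs K v \<Longrightarrow> x n \<in> carrier K"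
  by (simp add: cauchy_seqs_def)

lemma cauchy_seqsE:
  assumes "x \<in> cauchy_seqs K v"
  obtains M where "\<And>m n. M \<le> m \<Longrightarrow> M \<le> n \<Longrightarrow> Fin N \<le> v (x m \<ominus> x n)"
  using assms unfolding cauchy_seqs_def by blast

text \<open>Late terms differ from the fixed term \<open>x M\<close> by something of value at least
  0, and \<open>v (x M)\<close> has a finite lower bound. Only a tail is bounded, which suffices for
  the Cauchy and null conditions.\<close>

lemma cauchy_seqs_bounded:
  assumes "x \<in> cauchy_seqs K v"
  obtains B M where "\<And>n. M \<le> n \<Longrightarrow> Fin B \<le> v (x n)"
proof -
  note cl = cauchy_seqs_closed[OF assms]
  obtain M where M: "\<And>m n. M \<le> m \<Longrightarrow> M \<le> n \<Longrightarrow> Fin 0 \<le> v (x m \<ominus> x n)"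
    using cauchy_seqsE[OF assms] by blast
  obtain C where C: "Fin C \<le> v (x M)" using v_lower cl by blast
  have "Fin (min 0 C) \<le> v (x n)" if "M \<le> n" for n
  proof -
    have "Fin (min 0 C) \<le> v ((x n \<ominus> x M) \<oplus> x M)"
      using C M[OF that order_refl] cl
      by (intro v_add_ge) (auto intro: order_trans[of _ "Fin 0"] order_trans[of _ "Fin C"])
    also have "(x n \<ominus> x M) \<oplus> x M = x n"
      using cl by (simp add: minus_eq a_assoc l_neg)
    finally show ?thesis .
  qed
  then show thesis by (rule that)
qed

lemma null_seqs_subset_cauchy_seqs: "null_seqs K v \<subseteq> cauchy_seqs K v"
proof
  fix x assume x: "x \<in> null_seqs K v"
  then have cl: "x n \<in> carrier K" for n by (simp add: null_seqs_def)
  have "\<exists>M. \<forall>m\<ge>M. \<forall>n\<ge>M. Fin N \<le> v (x m \<ominus> x n)" for N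
  proof -
    obtain M where "\<And>n. M \<le> n \<Longrightarrow> Fin N \<le> v (x n)"
      using x unfolding null_seqs_def by blast
    then show ?thesis
      using cl by (intro exI[of _ M]) (auto simp: minus_eq v_neg intro!: v_add_ge)
  qed
  then show "x \<in> cauchy_seqs K v" using cl by (simp add: cauchy_seqs_def)
qed

lemma const_cauchy_seqs: "a \<in> carrier K \<Longrightarrow> (\<lambda>n. a) \<in> cauchy_seqs K v"
  by (simp add: cauchy_seqs_def minus_eq r_neg)

lemma cauchy_seqs_neg:
  assumes "x \<in> cauchy_seqs K v"
  shows "(\<lambda>n. \<ominus> x n) \<in> cauchy_seqs K v"
proof -
  have "\<ominus> x m \<ominus> \<ominus> x n = \<ominus> (x m \<ominus> x n)" and "x n \<in> carrier K" for m n
    using assms by (simp_all add: cauchy_seqs_def minus_eq minus_add)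
  then show ?thesis using assms by (simp add: cauchy_seqs_def v_neg)
qed

lemma cauchy_seqs_add:
  assumes "x \<in> cauchy_seqs K v" "y \<in> cauchy_seqs K v"
  shows "(\<lambda>n. x n \<oplus> y n) \<in> cauchy_seqs K v"
proof -
  note cl = cauchy_seqs_closed[OF assms(1)] cauchy_seqs_closed[OF assms(2)]
  have "\<exists>M. \<forall>m\<ge>M. \<forall>n\<ge>M. Fin N \<le> v ((x m \<oplus> y m) \<ominus> (x n \<oplus> y n))" for N
  proof -
    obtain M1 where M1: "\<And>m n. M1 \<le> m \<Longrightarrow> M1 \<le> n \<Longrightarrow> Fin N \<le> v (x m \<ominus> x n)"
      using cauchy_seqsE[OF assms(1)] by blast
    obtain M2 where M2: "\<And>m n. M2 \<le> m \<Longrightarrow> M2 \<le> n \<Longrightarrow> Fin N \<le> v (y m \<ominus> y n)"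
      using cauchy_seqsE[OF assms(2)] by blast
    have "Fin N \<le> v ((x m \<oplus> y m) \<ominus> (x n \<oplus> y n))"
      if "max M1 M2 \<le> m" "max M1 M2 \<le> n" for m n
    proof -
      have "(x m \<oplus> y m) \<ominus> (x n \<oplus> y n) = (x m \<ominus> x n) \<oplus> (y m \<ominus> y n)"
        using cl by (simp add: minus_eq minus_add a_ac)
      then show ?thesis using M1 M2 that cl by (auto intro!: v_add_ge)
    qed
    then show ?thesis by blast
  qed
  then show ?thesis using cl by (simp add: cauchy_seqs_def)
qed

lemma null_seqs_mult:
  assumes "x \<in> cauchy_seqs K v" "y \<in> null_seqs K v"
  shows "(\<lambda>n. x n \<otimes> y n) \<in> null_seqs K v"
proof -
  have cl: "x n \<in> carrier K" "y n \<in> carrier K" for n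
    using assms by (simp_all add: cauchy_seqs_def null_seqs_def)
  obtain B M1 where B: "\<And>n. M1 \<le> n \<Longrightarrow> Fin B \<le> v (x n)"
    using cauchy_seqs_bounded[OF assms(1)] by blast
  have "\<exists>M. \<forall>n\<ge>M. Fin N \<le> v (x n \<otimes> y n)" for N
  proof -
    \<comment> \<open>The precision \<open>N - B\<close> compensates for the bound \<open>B\<close>
      on the other factor, which may be negative.\<close>
    obtain M2 where M2: "\<And>n. M2 \<le> n \<Longrightarrow> Fin (N - B) \<le> v (y n)"
      using assms(2) unfolding null_seqs_def by blast
    have "Fin N \<le> v (x n \<otimes> y n)" if "max M1 M2 \<le> n" for n
      using v_mult_ge[OF cl(1)[of n] cl(2)[of n] B M2] that by simp
    then show ?thesis by blast
  qed
  then show ?thesis using cl by (simp add: null_seqs_def)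
qed

lemma cauchy_seqs_mult:
  assumes "x \<in> cauchy_seqs K v" "y \<in> cauchy_seqs K v"
  shows "(\<lambda>n. x n \<otimes> y n) \<in> cauchy_seqs K v"
proof -
  note cl = cauchy_seqs_closed[OF assms(1)] cauchy_seqs_closed[OF assms(2)]
  obtain B1 M1 where B1: "\<And>n. M1 \<le> n \<Longrightarrow> Fin B1 \<le> v (x n)"
    using cauchy_seqs_bounded[OF assms(1)] by blast
  obtain B2 M2 where B2: "\<And>n. M2 \<le> n \<Longrightarrow> Fin B2 \<le> v (y n)"
    using cauchy_seqs_bounded[OF assms(2)] by blast
  have "\<exists>M. \<forall>m\<ge>M. \<forall>n\<ge>M. Fin N \<le> v (x m \<otimes> y m \<ominus> x n \<otimes> y n)" for N
  proof -
    obtain M3 where M3: "\<And>m n. M3 \<le> m \<Longrightarrow> M3 \<le> n \<Longrightarrow> Fin (N - B2) \<le> v (x m \<ominus> x n)"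
      using cauchy_seqsE[OF assms(1)] by blast
    obtain M4 where M4: "\<And>m n. M4 \<le> m \<Longrightarrow> M4 \<le> n \<Longrightarrow> Fin (N - B1) \<le> v (y m \<ominus> y n)"
      using cauchy_seqsE[OF assms(2)] by blast
    define M where "M = Max {M1, M2, M3, M4}"
    have "Fin N \<le> v (x m \<otimes> y m \<ominus> x n \<otimes> y n)" if mn: "M \<le> m" "M \<le> n" for m n
    proof -
      \<comment> \<open>Each summand has one bounded factor and one difference; the precision asked
        of each difference was shifted by the bound of the factor that multiplies it.\<close>
      have "x m \<otimes> y m \<ominus> x n \<otimes> y n = x m \<otimes> (y m \<ominus> y n) \<oplus> (x m \<ominus> x n) \<otimes> y n"
        using cl by algebra
      moreover have "Fin (B1 + (N - B1)) \<le> v (x m \<otimes> (y m \<ominus> y n))"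
        using mn cl by (intro v_mult_ge B1 M4) (auto simp: M_def)
      moreover have "Fin ((N - B2) + B2) \<le> v ((x m \<ominus> x n) \<otimes> y n)"
        using mn cl by (intro v_mult_ge B2 M3) (auto simp: M_def)
      ultimately show ?thesis using cl by (auto intro!: v_add_ge)
    qed
    then show ?thesis by blast
  qed
  then show ?thesis using cl by (simp add: cauchy_seqs_def)
qed

section \<open>The completion as a quotient of the ring of Cauchy sequences\<close>

lemma cring_cauchy_ring: "cring (cauchy_ring K v)"
proof (rule cringI)
  note cl = cauchy_seqs_closed
  show "abelian_group (cauchy_ring K v)"
  proof (rule abelian_groupI)
    fix x assume x: "x \<in> carrier (cauchy_ring K v)"
    show "\<exists>y\<in>carrier (cauchy_ring K v). y \<oplus>\<^bsub>cauchy_ring K v\<^esub> x = \<zero>\<^bsub>cauchy_ring K v\<^esub>"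
      using x cauchy_seqs_neg[of x] cl[of x]
      by (intro bexI[of _ "\<lambda>n. \<ominus> x n"]) (auto simp: cauchy_ring_def l_neg)
  qed (auto simp: cauchy_ring_def cl a_ac cauchy_seqs_add const_cauchy_seqs)
  show "comm_monoid (cauchy_ring K v)"
    by (rule comm_monoidI) (auto simp: cauchy_ring_def cl m_ac cauchy_seqs_mult const_cauchy_seqs)
qed (auto simp: cauchy_ring_def cauchy_seqs_closed l_distr)

lemma ideal_null_seqs: "ideal (null_seqs K v) (cauchy_ring K v)"
proof -
  interpret C: cring "cauchy_ring K v" by (rule cring_cauchy_ring)
  have cl: "x n \<in> carrier K" if "x \<in> null_seqs K v" for x n
    using that by (simp add: null_seqs_def)
  have mult: "(\<lambda>n. x n \<otimes> y n) \<in> null_seqs K v" "(\<lambda>n. y n \<otimes> x n) \<in> null_seqs K v"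
    if "x \<in> cauchy_seqs K v" "y \<in> null_seqs K v" for x y
  proof -
    show "(\<lambda>n. x n \<otimes> y n) \<in> null_seqs K v" using null_seqs_mult[OF that] .
    moreover have "(\<lambda>n. y n \<otimes> x n) = (\<lambda>n. x n \<otimes> y n)"
      using that by (simp add: cauchy_seqs_def null_seqs_def m_comm)
    ultimately show "(\<lambda>n. y n \<otimes> x n) \<in> null_seqs K v" by simp
  qed
  show ?thesis
  proof (rule idealI)
    show "ring (cauchy_ring K v)" by (rule C.ring_axioms)
    show "subgroup (null_seqs K v) (add_monoid (cauchy_ring K v))"
    proof (rule C.add.subgroupI)
      show "null_seqs K v \<subseteq> carrier (cauchy_ring K v)"
        using null_seqs_subset_cauchy_seqs by (simp add: cauchy_ring_def)
      have "(\<lambda>n. \<zero>) \<in> null_seqs K v" by (simp add: null_seqs_def)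
      then show "null_seqs K v \<noteq> {}" by blast
    next
      fix x assume x: "x \<in> null_seqs K v"
      then have nx: "(\<lambda>n. \<ominus> x n) \<in> null_seqs K v"
        by (simp add: null_seqs_def v_neg)
      \<comment> \<open>Negation in a ring structure is defined abstractly, so it is identified with
        termwise negation through uniqueness of inverses.\<close>
      have "\<ominus>\<^bsub>cauchy_ring K v\<^esub> x = (\<lambda>n. \<ominus> x n)"
        using x nx cl[OF x] null_seqs_subset_cauchy_seqs
        by (intro C.minus_equality) (auto simp: cauchy_ring_def l_neg)
      then show "\<ominus>\<^bsub>cauchy_ring K v\<^esub> x \<in> null_seqs K v" using nx by simp
    next
      fix x y assume xy: "x \<in> null_seqs K v" "y \<in> null_seqs K v"
      have "\<exists>M. \<forall>n\<ge>M. Fin N \<le> v (x n \<oplus> y n)" for N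
      proof -
        obtain M1 M2 where "\<And>n. M1 \<le> n \<Longrightarrow> Fin N \<le> v (x n)" "\<And>n. M2 \<le> n \<Longrightarrow> Fin N \<le> v (y n)"
          using xy unfolding null_seqs_def by blast
        then show ?thesis
          using xy cl by (intro exI[of _ "max M1 M2"]) (auto intro!: v_add_ge)
      qed
      then show "x \<oplus>\<^bsub>cauchy_ring K v\<^esub> y \<in> null_seqs K v"
        using xy by (simp add: cauchy_ring_def null_seqs_def)
    qed
  qed (auto simp: cauchy_ring_def mult)
qed

text \<open>The embedding is the constant-sequence map followed by the quotient map. The completion
  is used as a commutative ring, which is why matrices and Witt indices are treated in
  \<open>cring\<close>.\<close>

lemma ring_hom_cring_completion_embed:
  "ring_hom_cring K (completion K v) (completion_embed K v)"
proof -
  interpret I: ideal "null_seqs K v" "cauchy_ring K v" by (rule ideal_null_seqs)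
  interpret Q: ring_hom_cring "cauchy_ring K v" "completion K v" "(+>\<^bsub>cauchy_ring K v\<^esub>) (null_seqs K v)"
    unfolding completion_def by (rule I.rcos_ring_hom_cring[OF cring_cauchy_ring])
  have "(\<lambda>a n. a) \<in> ring_hom K (cauchy_ring K v)"
    by (rule ring_hom_memI) (auto simp: cauchy_ring_def const_cauchy_seqs)
  then have "(+>\<^bsub>cauchy_ring K v\<^esub>) (null_seqs K v) \<circ> (\<lambda>a n. a) \<in> ring_hom K (completion K v)"
    using Q.homh by (rule ring_hom_trans)
  moreover have "(+>\<^bsub>cauchy_ring K v\<^esub>) (null_seqs K v) \<circ> (\<lambda>a n. a) = completion_embed K v"
    by (simp add: fun_eq_iff completion_embed_def)
  ultimately show ?thesis
    by unfold_locales simp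
qed

lemma witt_index_base_change_orth_sum_ge:
  assumes "regular_qform K q" "regular_qform K \<tau>"
  shows "witt_index (completion K v) (base_change K v q)
    \<le> witt_index (completion K v) (base_change K v (orth_sum K q \<tau>))"
proof -
  interpret E: ring_hom_cring K "completion K v" "completion_embed K v"
    by (rule ring_hom_cring_completion_embed)
  \<comment> \<open>An equality of forms, since the off-diagonal zeros are sent to the zero of the
    completion.\<close>
  have "base_change K v (orth_sum K q \<tau>) = orth_sum (completion K v) (base_change K v q) (base_change K v \<tau>)"
    by (auto simp: base_change_def orth_sum_def fun_eq_iff)
  moreover have "regular_qform (completion K v) (base_change K v p)" if "regular_qform K p" for p
    using E.regular_qform_hom[OF that] by (simp add: base_change_def)
  ultimately show ?thesis
    using assms E.S.witt_index_orth_sum_ge by simp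
qed

text \<open>The zero form lies outside the range \<open>1 \<le> qdim q\<close> over which
  \<open>m_invariant\<close> is taken, so the extension lemmas do not cover it; this value settles
  that case.\<close>

lemma witt_index_base_change_dim_0:
  assumes "regular_qform K q" "qdim q = 0"
  shows "witt_index (completion K v) (base_change K v q) = 0"
proof -
  interpret E: ring_hom_cring K "completion K v" "completion_embed K v"
    by (rule ring_hom_cring_completion_embed)
  let ?W = "witt_decompositions (completion K v) (base_change K v q)"
  have "regular_qform (completion K v) (base_change K v q)"
    using E.regular_qform_hom[OF assms(1)] by (simp add: base_change_def)
  then have "0 \<in> ?W"
    by (rule E.S.zero_in_witt_decompositions)
  moreover have "m = 0" if "m \<in> ?W" for m
    using witt_decompositions_le[OF that] assms(2) by (simp add: base_change_def)
  ultimately have "?W = {0}" by blast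
  then show ?thesis by (simp add: witt_index_Max)
qed

end

section \<open>Descent of the local-global principle to smaller dimensions\<close>

theorem theorem4p3:
  fixes K :: "('a, 'b) ring_scheme"
    and V :: "('a \<Rightarrow> int extended) set"
    and i j s r m :: nat
  assumes "field K"
    and "\<one>\<^bsub>K\<^esub> \<oplus>\<^bsub>K\<^esub> \<one>\<^bsub>K\<^esub> \<noteq> \<zero>\<^bsub>K\<^esub>"
    and "V \<noteq> {}"
    and "\<forall>v\<in>V. discrete_valuation K v \<and> nontrivial_valuation K v"
    and "1 \<le> i" and "1 \<le> j"
    and "1 \<le> s" and "s \<le> i"
    and "1 \<le> r"
    and "m_invariant K i j = enat m"
    and "\<forall>q. regular_qform K q \<and> qdim q = m + s - 1 \<longrightarrow> LGP K V r j q"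
  shows "\<forall>q. regular_qform K q \<and> qdim q < m \<longrightarrow> LGP K V r j q"
proof (intro allI impI)
  interpret field K by fact
  have val: "valued_field K v" if "v \<in> V" for v
    using that assms(4) by unfold_locales auto
  fix q assume q: "regular_qform K q \<and> qdim q < m"
  show "LGP K V r j q"
    unfolding LGP_def
  proof (rule impI, rule ccontr)
    assume loc: "\<forall>v\<in>V. r \<le> witt_index (completion K v) (base_change K v q)"
      and "\<not> j \<le> witt_index K q"
    then have j: "witt_index K q < j" by simp
    \<comment> \<open>For the zero form, any member of the nonempty set \<open>V\<close> would give
      \<open>r \<le> 0\<close>, against \<open>1 \<le> r\<close>.\<close>
    have "1 \<le> qdim q"
    proof (rule ccontr)
      assume "\<not> 1 \<le> qdim q"
      then show False
        using loc q assms(3,9) valued_field.witt_index_base_change_dim_0[OF val]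
        by fastforce
    qed
    then obtain \<rho> where \<rho>: "regular_qform K \<rho>" "qdim q + qdim \<rho> = m + s - 1"
      "witt_index K (orth_sum K q \<rho>) < j"
      using regular_qform_extend_to[OF assms(2) _ _ j assms(10) _ assms(5,8)] q by metis
    have "r \<le> witt_index (completion K v) (base_change K v (orth_sum K q \<rho>))" if "v \<in> V" for v
      using valued_field.witt_index_base_change_orth_sum_ge[OF val[OF that]] loc that q \<rho>(1)
      by (meson order_trans)
    \<comment> \<open>The enlarged form has exactly the dimension for which the principle is
      assumed; it meets the local condition although its Witt index is below
      \<open>j\<close>.\<close>
    moreover have "LGP K V r j (orth_sum K q \<rho>)"
      using assms(11) q \<rho> by (simp add: regular_orth_sum_iff del: gram_orth_sum)
    ultimately show False
      using \<rho>(3) by (simp add: LGP_def)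
  qed
qed

end
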